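(* Let $\mathcal{C}$ be an analytic curve, let $q\ge 2$, and let $M_1,\dots,M_q:\mathcal{C}\to \mathrm{SL}_n(\mathbb{C})$ be analytic maps. Suppose $M_1$ and $M_2$ are irreducible on $\mathcal{C}$ except at a subset of isolated points. Suppose $M_1$ is locally diagonalizable at each point $p\in\mathcal{C}$, and that no two local analytic eigenvalues of $M_1$ are identically equal. Then $M_1,\dots,M_q$ are globally simultaneously unitarizable on $\mathcal{C}$ if and only if the following conditions hold: (i) $M_1,\dots,M_q$ are pointwise simultaneously unitarizable at each point of $\mathcal{C}$. (ii) For each $p\in\mathcal{C}$, letting $C$ be a local diagonalizer of $M_1$ at $p$ and $P_2=CM_2C^{-1}$, the maps $P_2$ and ${P_2^\ast}^{-1}$ are $G$-compatible at $p$ for some connected $\Xi_n$-graph $G$. In this case, any simultaneous unitarizer is unique up to left multiplication by an analytic map $\mathcal{C}\to\mathrm{SU}_n$.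
   Context: An analytic curve is a connected real analytic one-dimensional manifold without boundary; "analytic" means real analytic. For a matrix map $M$, $M^\ast=\overline{M}^{\,t}$ (pointwise conjugate transpose). Two matrices $A,B\in M_{n\times n}(\mathbb{C})$ are reducible if there is a proper nonzero subspace $W\subset\mathbb{C}^n$ with $AW\subset W$ and $BW\subset W$, and irreducible otherwise; for maps this is understood pointwise. $M_1:\mathcal{C}\to\mathrm{SL}_n(\mathbb{C})$ is locally diagonalizable at $p$ if there are a neighborhood $\mathcal{U}$ of $p$ and an analytic map $C:\mathcal{U}\to\mathrm{SL}_n(\mathbb{C})$ (a local diagonalizer at $p$) such that $CM_1C^{-1}$ is diagonal; the diagonal entries are then the local analytic eigenvalues of $M_1$ near $p$. Maps $M_1,\dots,M_q$ are (globally) simultaneously unitarizable on $\mathcal{C}$ if there is an analytic $V:\mathcal{C}\to\mathrm{SL}_n(\mathbb{C})$ (a simultaneous unitarizer) such that every $VM_kV^{-1}$ takes values in $\mathrm{SU}_n$. They are pointwise simultaneously unitarizable at $p$ if there is a matrix $V\in\mathrm{SL}_n(\mathbb{C})$ with $VM_k(p)V^{-1}\in\mathrm{SU}_n$ for all $k$. A $\Xi_n$-graph is a directed graph with vertex set $\{1,\dots,n\}$, without repeated edges, but possibly with edges from a vertex to itself; it is connected if it is connected as an undirected graph. For a $\Xi_n$-graph $G$, two analytic $M_{n\times n}(\mathbb{C})$-valued maps $A,B$ near $p$ are $G$-compatible at $p$ if for every directed edge $(\mu,\nu)$ of $G$ one has $\mathrm{ord}_p A_{\mu\nu}=\mathrm{ord}_p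 B_{\mu\nu}<\infty$, where $A_{\mu\nu}$ is the entry in row $\mu$ and column $\nu$ and $\mathrm{ord}_p$ is the order of vanishing at $p$ ($\infty$ for a function vanishing identically near $p$). *)

theory Defs
  imports "HOL-Analysis.Analysis" "HOL-Library.Extended_Nat"
begin

section \<open>Real analytic functions of one real variable\<close>

text \<open>The target is an arbitrary real normed space, so that one notion covers real-, complex-
  and matrix-valued functions.\<close>

definition real_analytic_at :: "(real \<Rightarrow> 'b::real_normed_vector) \<Rightarrow> real \<Rightarrow> bool" where
  "real_analytic_at f t \<longleftrightarrow>
     (\<exists>a r. 0 < r \<and> (\<forall>s. \<bar>s - t\<bar> < r \<longrightarrow> (\<lambda>k::nat. (s - t) ^ k *\<^sub>R a k) sums f s))"

text \<open>The value is only meaningful for functions that are analytic at \<open>t\<close>.\<close>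

definition vanishing_order :: "(real \<Rightarrow> complex) \<Rightarrow> real \<Rightarrow> enat" where
  "vanishing_order f t =
     (if \<forall>\<^sub>F s in nhds t. f s = 0 then \<infinity>
      else enat (THE k. \<exists>h. real_analytic_at h t \<and> h t \<noteq> 0 \<and>
                            (\<forall>\<^sub>F s in nhds t. f s = (s - t) ^ k *\<^sub>R h s)))"


section \<open>Analytic curves\<close>

text \<open>A chart is a pair \<open>(U, \<phi>)\<close> with \<open>\<phi>\<close> a homeomorphism from the open set \<open>U\<close> onto an open
  subset of the reals; as usual, manifolds are Hausdorff and second countable. The atlas
  \<open>\<A>\<close> need not be maximal.\<close>

definition analytic_curve :: "'a topology \<Rightarrow> ('a set \<times> ('a \<Rightarrow> real)) set \<Rightarrow> bool" where
  "analytic_curve X \<A> \<longleftrightarrow>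
     Hausdorff_space X \<and> second_countable X \<and> connected_space X \<and>
     (\<Union>(U, \<phi>)\<in>\<A>. U) = topspace X \<and>
     (\<forall>(U, \<phi>)\<in>\<A>. openin X U \<and> open (\<phi> ` U) \<and>
        homeomorphic_map (subtopology X U) (top_of_set (\<phi> ` U)) \<phi>) \<and>
     (\<forall>(U, \<phi>)\<in>\<A>. \<forall>(V, \<psi>)\<in>\<A>. \<forall>t\<in>\<phi> ` (U \<inter> V). real_analytic_at (\<psi> \<circ> inv_into U \<phi>) t)"

text \<open>Intended for \<open>W\<close> open in the curve, in which case only the values of \<open>f\<close> on \<open>W\<close> matter.\<close>

definition curve_analytic_on ::
    "('a set \<times> ('a \<Rightarrow> real)) set \<Rightarrow> 'a set \<Rightarrow> ('a \<Rightarrow> 'b::real_normed_vector) \<Rightarrow> bool" where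
  "curve_analytic_on \<A> W f \<longleftrightarrow>
     (\<forall>(U, \<phi>)\<in>\<A>. \<forall>p\<in>U \<inter> W. real_analytic_at (f \<circ> inv_into U \<phi>) (\<phi> p))"


section \<open>Matrices\<close>

definition conj_transpose :: "complex ^ 'n ^ 'm \<Rightarrow> complex ^ 'm ^ 'n" where
  "conj_transpose A = (\<chi> i j. cnj (A $ j $ i))"

definition SL :: "(complex ^ 'n ^ 'n) set" where
  "SL = {A. det A = 1}"

definition SU :: "(complex ^ 'n ^ 'n) set" where
  "SU = {A. conj_transpose A ** A = mat 1 \<and> det A = 1}"

definition is_diagonal :: "complex ^ 'n ^ 'n \<Rightarrow> bool" where
  "is_diagonal A \<longleftrightarrow> (\<forall>i j. i \<noteq> j \<longrightarrow> A $ i $ j = 0)"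

definition conjugate_by :: "complex ^ 'n ^ 'n \<Rightarrow> complex ^ 'n ^ 'n \<Rightarrow> complex ^ 'n ^ 'n" where
  "conjugate_by V A = V ** A ** matrix_inv V"

text \<open>\<open>vec.subspace\<close> is the complex-linear notion here (plain \<open>subspace\<close> would be real-linear).\<close>

definition reducible_pair :: "complex ^ 'n ^ 'n \<Rightarrow> complex ^ 'n ^ 'n \<Rightarrow> bool" where
  "reducible_pair A B \<longleftrightarrow>
     (\<exists>W. vec.subspace W \<and> W \<noteq> {0} \<and> W \<noteq> UNIV \<and> (*v) A ` W \<subseteq> W \<and> (*v) B ` W \<subseteq> W)"


section \<open>Diagonalizers and unitarizers on a curve\<close>

definition irreducible_except_isolated ::
    "'a topology \<Rightarrow> ('a \<Rightarrow> complex ^ 'n ^ 'n) \<Rightarrow> ('a \<Rightarrow> complex ^ 'n ^ 'n) \<Rightarrow> bool" where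
  "irreducible_except_isolated X A B \<longleftrightarrow>
     (\<exists>S\<subseteq>topspace X. (\<forall>p\<in>S. \<exists>U. openin X U \<and> U \<inter> S = {p}) \<and>
        (\<forall>p\<in>topspace X - S. \<not> reducible_pair (A p) (B p)))"

definition local_diagonalizer ::
    "'a topology \<Rightarrow> ('a set \<times> ('a \<Rightarrow> real)) set \<Rightarrow> ('a \<Rightarrow> complex ^ 'n ^ 'n) \<Rightarrow> 'a \<Rightarrow>
     'a set \<Rightarrow> ('a \<Rightarrow> complex ^ 'n ^ 'n) \<Rightarrow> bool" where
  "local_diagonalizer X \<A> A p U C \<longleftrightarrow>
     openin X U \<and> p \<in> U \<and> curve_analytic_on \<A> U C \<and> C ` U \<subseteq> SL \<and>
     (\<forall>x\<in>U. is_diagonal (conjugate_by (C x) (A x)))"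

definition locally_diagonalizable_at ::
    "'a topology \<Rightarrow> ('a set \<times> ('a \<Rightarrow> real)) set \<Rightarrow> ('a \<Rightarrow> complex ^ 'n ^ 'n) \<Rightarrow> 'a \<Rightarrow> bool" where
  "locally_diagonalizable_at X \<A> A p \<longleftrightarrow> (\<exists>U C. local_diagonalizer X \<A> A p U C)"

text \<open>The local eigenvalues near \<open>p\<close> are compared as germs at \<open>p\<close>.\<close>

definition local_eigenvalues_distinct ::
    "'a topology \<Rightarrow> ('a set \<times> ('a \<Rightarrow> real)) set \<Rightarrow> ('a \<Rightarrow> complex ^ 'n ^ 'n) \<Rightarrow> 'a \<Rightarrow> bool" where
  "local_eigenvalues_distinct X \<A> A p \<longleftrightarrow>
     (\<forall>U C i j. local_diagonalizer X \<A> A p U C \<and> i \<noteq> j \<longrightarrow>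
        \<not> (\<forall>\<^sub>F x in nhdsin X p.
              conjugate_by (C x) (A x) $ i $ i = conjugate_by (C x) (A x) $ j $ j))"

text \<open>The maps to be unitarized are \<open>M 1, \<dots>, M q\<close>.\<close>

definition simultaneous_unitarizer ::
    "'a topology \<Rightarrow> ('a set \<times> ('a \<Rightarrow> real)) set \<Rightarrow> nat \<Rightarrow> (nat \<Rightarrow> 'a \<Rightarrow> complex ^ 'n ^ 'n) \<Rightarrow>
     ('a \<Rightarrow> complex ^ 'n ^ 'n) \<Rightarrow> bool" where
  "simultaneous_unitarizer X \<A> q M V \<longleftrightarrow>
     curve_analytic_on \<A> (topspace X) V \<and> V ` topspace X \<subseteq> SL \<and>
     (\<forall>k\<in>{1..q}. \<forall>x\<in>topspace X. conjugate_by (V x) (M k x) \<in> SU)"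

definition globally_unitarizable ::
    "'a topology \<Rightarrow> ('a set \<times> ('a \<Rightarrow> real)) set \<Rightarrow> nat \<Rightarrow> (nat \<Rightarrow> 'a \<Rightarrow> complex ^ 'n ^ 'n) \<Rightarrow> bool"
  where
  "globally_unitarizable X \<A> q M \<longleftrightarrow> (\<exists>V. simultaneous_unitarizer X \<A> q M V)"

definition pointwise_unitarizable_at ::
    "nat \<Rightarrow> (nat \<Rightarrow> 'a \<Rightarrow> complex ^ 'n ^ 'n) \<Rightarrow> 'a \<Rightarrow> bool" where
  "pointwise_unitarizable_at q M p \<longleftrightarrow>
     (\<exists>V\<in>SL. \<forall>k\<in>{1..q}. conjugate_by V (M k p) \<in> SU)"


section \<open>Graphs and compatibility\<close>

text \<open>A directed graph on the index type without repeated edges (loops allowed) is just its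
  edge relation.\<close>

definition connected_graph :: "('n \<times> 'n) set \<Rightarrow> bool" where
  "connected_graph G \<longleftrightarrow> (G \<union> G\<inverse>)\<^sup>* = UNIV"

text \<open>Since transition maps are analytic diffeomorphisms, orders of vanishing do not depend on
  the chart; quantifying over all charts at \<open>p\<close> avoids choosing one.\<close>

definition G_compatible_at ::
    "('a set \<times> ('a \<Rightarrow> real)) set \<Rightarrow> ('n \<times> 'n) set \<Rightarrow> 'a \<Rightarrow>
     ('a \<Rightarrow> complex ^ 'n ^ 'n) \<Rightarrow> ('a \<Rightarrow> complex ^ 'n ^ 'n) \<Rightarrow> bool" where
  "G_compatible_at \<A> G p A B \<longleftrightarrow>
     (\<forall>(U, \<phi>)\<in>\<A>. p \<in> U \<longrightarrow>
        (\<forall>(\<mu>, \<nu>)\<in>G.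
           vanishing_order (\<lambda>t. A (inv_into U \<phi> t) $ \<mu> $ \<nu>) (\<phi> p)
             = vanishing_order (\<lambda>t. B (inv_into U \<phi> t) $ \<mu> $ \<nu>) (\<phi> p) \<and>
           vanishing_order (\<lambda>t. A (inv_into U \<phi> t) $ \<mu> $ \<nu>) (\<phi> p) < \<infinity>))"

end

theory Submission
  imports Defs "HOL-Complex_Analysis.Conformal_Mappings"
begin

text \<open>A matrix \<open>V\<close> unitarizes \<open>M\<^sub>1, \<dots>, M\<^sub>q\<close> exactly when the positive definite form \<open>H = V\<^sup>* V\<close> satisfies
\<open>M\<^sub>k\<^sup>* H M\<^sub>k = H\<close> for all \<open>k\<close>, and \<open>V\<close> is recovered from \<open>H\<close> up to a left unitary factor. So the theorem
is about the invariant forms of determinant one (\<open>invariant_forms\<close>): pointwise unitarizability says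
that one exists at every point, and global unitarizability that they can be chosen to depend
analytically on the point.

In a local diagonalizer the problem becomes scalar. If \<open>D\<close> is diagonal with distinct
eigenvalues, an invariant form must be diagonal (\<open>invariant_form_diagonal\<close>); eigenvalues coincide
only at isolated points, so this holds in a punctured neighbourhood of each point. A diagonal form
with entries \<open>h\<^sub>i\<close> is invariant under \<open>P\<close> only if \<open>h\<^sub>i P\<^sub>i\<^sub>j = R\<^sub>i\<^sub>j h\<^sub>j\<close> with \<open>R\<close> the inverse of \<open>P\<^sup>*\<close>
(\<open>diagonal_invariant_form_ratio\<close>). If \<open>P\<^sub>i\<^sub>j\<close> and \<open>R\<^sub>i\<^sub>j\<close> vanish to the same finite order at the point,
then \<open>h\<^sub>i / h\<^sub>j\<close> extends to a nonvanishing analytic function. Along a connected graph this determines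
all ratios, and the normalization \<open>\<Prod>h\<^sub>j = 1\<close> then gives \<open>h\<^sub>i\<^sup>n = \<Prod>\<^sub>j h\<^sub>i / h\<^sub>j\<close>. Hence the form is unique
near the point (the point itself excepted) and extends analytically to an invariant form at the
point (\<open>ex_analytic_invariant_form\<close>).

Sufficiency: as the local forms are limits of the unique forms at nearby points, they agree on
overlaps and give one analytic form \<open>Q\<close> on the whole curve (\<open>ex_analytic_form\<close>). No monodromy can
arise in passing from \<open>Q\<close> to \<open>V\<close>, because Gram-Schmidt applied to the standard basis is a single
analytic map \<open>\<Phi>\<close> on positive definite matrices with \<open>\<Phi>(Q)\<^sup>* \<Phi>(Q) = Q\<close> (\<open>analytic_gram_factor\<close>).

Necessity: a unitarizer gives an analytic diagonal form near each point, so \<open>R\<^sub>i\<^sub>j\<close> is a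
nonvanishing multiple of \<open>P\<^sub>i\<^sub>j\<close> and the orders agree (\<open>invariant_form_imp_equal_orders\<close>). The graph of the
entries of \<open>P\<close> that do not vanish identically is connected, since otherwise the basis
vectors of a component would span a proper invariant subspace at all nearby points
(\<open>irreducible_imp_connected_graph\<close>). Uniqueness follows:
two unitarizers define the same form off isolated points, hence everywhere by continuity.\<close>

section \<open>Analytic functions of one real variable\<close>

text \<open>A real power series that converges for \<open>\<bar>s - t\<bar> < r\<close> also converges on the complex disc of that
radius, and conversely a holomorphic function has a Taylor series. Closure under arithmetic operations and
logarithms is inherited through this extension.\<close>

lemma real_analytic_at_iff_analytic_extension:
  fixes f :: "real \<Rightarrow> complex"
  shows "real_analytic_at f t \<longleftrightarrow>
    (\<exists>F. F analytic_on {of_real t} \<and> (\<forall>\<^sub>F s in nhds t. f s = F (of_real s)))"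
proof
  assume "real_analytic_at f t"
  then obtain a r where r: "0 < r"
    and a: "\<And>s. \<bar>s - t\<bar> < r \<Longrightarrow> (\<lambda>k. (s - t) ^ k *\<^sub>R a k) sums f s"
    unfolding real_analytic_at_def by blast
  define F where "F = (\<lambda>z::complex. \<Sum>k. a k * (z - of_real t) ^ k)"
  have sums: "(\<lambda>k. a k * (z - of_real t) ^ k) sums F z" if "z \<in> ball (of_real t) r" for z
  proof -
    have "cmod (z - of_real t) < r"
      using that by (simp add: dist_norm norm_minus_commute)
    then obtain x where x: "cmod (z - of_real t) < x" "x < r"
      using dense by blast
    have x0: "0 < x" using x(1) norm_ge_zero[of "z - of_real t"] by linarith
    have "(\<lambda>k. (t + x - t) ^ k *\<^sub>R a k) sums f (t + x)"
      by (rule a) (use x x0 in auto)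
    then have "summable (\<lambda>k. a k * of_real x ^ k)"
      by (simp add: scaleR_conv_of_real mult.commute sums_iff)
    then have "summable (\<lambda>k. a k * (z - of_real t) ^ k)"
      by (rule powser_inside) (use x x0 in auto)
    then show ?thesis unfolding F_def by (rule summable_sums)
  qed
  have "F holomorphic_on ball (of_real t) r"
    using sums by (rule power_series_holomorphic)
  then have "F analytic_on {of_real t}"
    using r by (meson analytic_at_ball)
  moreover have "f s = F (of_real s)" if "dist s t < r" for s
  proof -
    have "(\<lambda>k. a k * (of_real s - of_real t) ^ k) sums F (of_real s)"
      by (rule sums) (use that in \<open>simp add: dist_commute dist_of_real\<close>)
    then have "(\<lambda>k. (s - t) ^ k *\<^sub>R a k) sums F (of_real s)"
      by (simp add: scaleR_conv_of_real mult.commute)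
    with a[of s] that show ?thesis
      by (auto simp: dist_real_def dest: sums_unique2)
  qed
  then have "\<forall>\<^sub>F s in nhds t. f s = F (of_real s)"
    using r unfolding eventually_nhds_metric by blast
  ultimately show "\<exists>F. F analytic_on {of_real t} \<and> (\<forall>\<^sub>F s in nhds t. f s = F (of_real s))"
    by blast
next
  assume "\<exists>F. F analytic_on {of_real t} \<and> (\<forall>\<^sub>F s in nhds t. f s = F (of_real s))"
  then obtain F d e where d: "0 < d" "F holomorphic_on ball (of_real t) d"
    and e: "0 < e" "\<And>s. dist s t < e \<Longrightarrow> f s = F (of_real s)"
    unfolding analytic_at_ball eventually_nhds_metric by blast
  let ?a = "\<lambda>n. (deriv ^^ n) F (of_real t) / fact n"
  have "(\<lambda>k. (s - t) ^ k *\<^sub>R ?a k) sums f s" if "\<bar>s - t\<bar> < min d e" for s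
  proof -
    have "(\<lambda>n. ?a n * (of_real s - of_real t) ^ n) sums F (of_real s)"
      by (rule holomorphic_power_series[OF d(2)])
        (use that in \<open>simp add: dist_of_real dist_real_def abs_minus_commute\<close>)
    then show ?thesis
      using that e(2)[of s] by (simp add: scaleR_conv_of_real mult.commute dist_real_def)
  qed
  then show "real_analytic_at f t"
    using d e unfolding real_analytic_at_def
    by (intro exI[of _ ?a] exI[of _ "min d e"]) auto
qed

lemma real_analytic_at_cong:
  assumes "\<forall>\<^sub>F s in nhds t. f s = g s"
  shows "real_analytic_at f t \<longleftrightarrow> real_analytic_at g t"
proof -
  have *: "real_analytic_at g t" if ev: "\<forall>\<^sub>F s in nhds t. f s = g s" and f: "real_analytic_at f t"
    for f g :: "real \<Rightarrow> 'b::real_normed_vector"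
  proof -
    obtain e where e: "0 < e" "\<forall>s. dist s t < e \<longrightarrow> f s = g s"
      using ev unfolding eventually_nhds_metric by auto
    obtain a r where ar: "0 < r" "\<And>s. \<bar>s - t\<bar> < r \<Longrightarrow> (\<lambda>k. (s - t) ^ k *\<^sub>R a k) sums f s"
      using f unfolding real_analytic_at_def by blast
    show ?thesis
      unfolding real_analytic_at_def
    proof (intro exI[of _ a] exI[of _ "min r e"] conjI allI impI)
      fix s assume "\<bar>s - t\<bar> < min r e"
      then show "(\<lambda>k. (s - t) ^ k *\<^sub>R a k) sums g s"
        using ar(2)[of s] e(2) by (simp add: dist_real_def)
    qed (use e ar in simp)
  qed
  have "\<forall>\<^sub>F s in nhds t. g s = f s"
    using assms by eventually_elim simp
  with assms show ?thesis using *[of f g] *[of g f] by blast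
qed

lemma real_analytic_at_bounded_linear:
  assumes "bounded_linear T" "real_analytic_at f t"
  shows "real_analytic_at (\<lambda>s. T (f s)) t"
proof -
  interpret bounded_linear T by fact
  obtain a r where ar: "0 < r" "\<And>s. \<bar>s - t\<bar> < r \<Longrightarrow> (\<lambda>k. (s - t) ^ k *\<^sub>R a k) sums f s"
    using assms(2) unfolding real_analytic_at_def by blast
  show ?thesis
    unfolding real_analytic_at_def
  proof (intro exI[of _ "\<lambda>k. T (a k)"] exI[of _ r] conjI allI impI)
    fix s assume "\<bar>s - t\<bar> < r"
    from sums[OF ar(2)[OF this]]
    show "(\<lambda>k. (s - t) ^ k *\<^sub>R T (a k)) sums T (f s)" by (simp add: scaleR)
  qed (fact ar(1))
qed

named_theorems real_analytic_intros

lemma real_analytic_at_const [real_analytic_intros]: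
  "real_analytic_at (\<lambda>s. c :: complex) t"
  unfolding real_analytic_at_iff_analytic_extension by (intro exI[of _ "\<lambda>_. c"]) auto

lemma real_analytic_at_cnj [real_analytic_intros]:
  "real_analytic_at f t \<Longrightarrow> real_analytic_at (\<lambda>s. cnj (f s)) t"
  by (rule real_analytic_at_bounded_linear[OF bounded_linear_cnj])

text \<open>Division and logarithms are analytic only where their argument is admissible; the equations at \<open>t\<close>
in the last premise carry this information over to the extensions.\<close>

lemma real_analytic_at_binop:
  fixes f g :: "real \<Rightarrow> complex"
  assumes "real_analytic_at f t" "real_analytic_at g t"
    and "\<And>F G. F analytic_on {of_real t} \<Longrightarrow> G analytic_on {of_real t} \<Longrightarrow>
           f t = F (of_real t) \<Longrightarrow> g t = G (of_real t) \<Longrightarrow> (\<lambda>z. h (F z) (G z)) analytic_on {of_real t}"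
  shows "real_analytic_at (\<lambda>s. h (f s) (g s)) t"
proof -
  obtain F G where F: "F analytic_on {of_real t}" "\<forall>\<^sub>F s in nhds t. f s = F (of_real s)"
    and G: "G analytic_on {of_real t}" "\<forall>\<^sub>F s in nhds t. g s = G (of_real s)"
    using assms(1,2) unfolding real_analytic_at_iff_analytic_extension by blast
  have "(\<lambda>z. h (F z) (G z)) analytic_on {of_real t}"
    using F G by (intro assms(3)) (auto dest: eventually_nhds_x_imp_x)
  moreover have "\<forall>\<^sub>F s in nhds t. h (f s) (g s) = h (F (of_real s)) (G (of_real s))"
    using F(2) G(2) by eventually_elim simp
  ultimately show ?thesis
    unfolding real_analytic_at_iff_analytic_extension by blast
qed

lemma real_analytic_at_add [real_analytic_intros]:
  fixes f g :: "real \<Rightarrow> complex"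
  shows "real_analytic_at f t \<Longrightarrow> real_analytic_at g t \<Longrightarrow> real_analytic_at (\<lambda>s. f s + g s) t"
  by (rule real_analytic_at_binop) (auto intro: analytic_intros)

lemma real_analytic_at_diff [real_analytic_intros]:
  fixes f g :: "real \<Rightarrow> complex"
  shows "real_analytic_at f t \<Longrightarrow> real_analytic_at g t \<Longrightarrow> real_analytic_at (\<lambda>s. f s - g s) t"
  by (rule real_analytic_at_binop) (auto intro: analytic_intros)

lemma real_analytic_at_mult [real_analytic_intros]:
  fixes f g :: "real \<Rightarrow> complex"
  shows "real_analytic_at f t \<Longrightarrow> real_analytic_at g t \<Longrightarrow> real_analytic_at (\<lambda>s. f s * g s) t"
  by (rule real_analytic_at_binop) (auto intro: analytic_intros)

lemma real_analytic_at_divide [real_analytic_intros]: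
  fixes f g :: "real \<Rightarrow> complex"
  shows "real_analytic_at f t \<Longrightarrow> real_analytic_at g t \<Longrightarrow> g t \<noteq> 0 \<Longrightarrow> real_analytic_at (\<lambda>s. f s / g s) t"
  by (rule real_analytic_at_binop) (auto intro: analytic_on_divide)

lemma real_analytic_at_sum [real_analytic_intros]:
  fixes f :: "'k \<Rightarrow> real \<Rightarrow> complex"
  shows "(\<And>k. k \<in> A \<Longrightarrow> real_analytic_at (f k) t) \<Longrightarrow> real_analytic_at (\<lambda>s. \<Sum>k\<in>A. f k s) t"
  by (induction A rule: infinite_finite_induct) (auto intro: real_analytic_intros)

lemma real_analytic_at_prod [real_analytic_intros]:
  fixes f :: "'k \<Rightarrow> real \<Rightarrow> complex"
  shows "(\<And>k. k \<in> A \<Longrightarrow> real_analytic_at (f k) t) \<Longrightarrow> real_analytic_at (\<lambda>s. \<Prod>k\<in>A. f k s) t"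
  by (induction A rule: infinite_finite_induct) (auto intro: real_analytic_intros)

text \<open>For positive \<open>f\<close> this is the \<open>n\<close>-th root, written with the complex logarithm so that it has a
holomorphic extension.\<close>

lemma real_analytic_at_exp_Ln_divide:
  fixes f :: "real \<Rightarrow> complex"
  assumes "real_analytic_at f t" "f t \<notin> \<real>\<^sub>\<le>\<^sub>0"
  shows "real_analytic_at (\<lambda>s. exp (Ln (f s) / of_nat n)) t"
proof -
  have "(\<lambda>z. exp (Ln (F z) / of_nat n)) analytic_on {of_real t}"
    if "F analytic_on {of_real t}" "f t = F (of_real t)" for F
    using that assms(2) by (cases "n = 0") (auto intro!: analytic_intros)
  then show ?thesis
    using real_analytic_at_binop[OF assms(1,1), of "\<lambda>u v. exp (Ln u / of_nat n)"] by auto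
qed

lemma real_analytic_at_imp_continuous:
  fixes f :: "real \<Rightarrow> complex"
  assumes "real_analytic_at f t"
  shows "isCont f t"
proof -
  obtain F where F: "F analytic_on {of_real t}" "\<forall>\<^sub>F s in nhds t. f s = F (of_real s)"
    using assms unfolding real_analytic_at_iff_analytic_extension by blast
  have "isCont F (of_real t)"
    using F(1) analytic_at_imp_isCont by blast
  then have "isCont (\<lambda>s. F (of_real s)) t"
    by (intro isCont_o2[where g = F and f = of_real] continuous_intros) auto
  then show ?thesis
    using isCont_cong[OF F(2)] by blast
qed

lemma real_analytic_at_factor:
  fixes f :: "real \<Rightarrow> complex"
  assumes "real_analytic_at f t" "\<not> (\<forall>\<^sub>F s in nhds t. f s = 0)"
  obtains k h where "real_analytic_at h t" "h t \<noteq> 0" "\<forall>\<^sub>F s in nhds t. f s = (s - t) ^ k *\<^sub>R h s"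
proof (cases "f t = 0")
  case False
  then show ?thesis using that[of f 0] assms(1) by simp
next
  case True
  obtain F d where F: "F analytic_on {of_real t}" "\<forall>\<^sub>F s in nhds t. f s = F (of_real s)"
    and d: "0 < d" "F holomorphic_on ball (of_real t) d"
    using assms(1) unfolding real_analytic_at_iff_analytic_extension analytic_at_ball by blast
  have ev: "\<forall>\<^sub>F s in nhds t. (of_real s :: complex) \<in> ball (of_real t) r" if "0 < r" for r
    using that unfolding eventually_nhds_metric by (auto simp: dist_of_real dist_commute)
  have F0: "F (of_real t) = 0"
    using eventually_nhds_x_imp_x[OF F(2)] True by simp
  have nc: "\<not> F constant_on ball (of_real t) d"
  proof
    assume "F constant_on ball (of_real t) d"
    then have Fz: "F z = 0" if "z \<in> ball (of_real t) d" for z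
      using that F0 d(1) unfolding constant_on_def by (metis centre_in_ball)
    have "\<forall>\<^sub>F s in nhds t. f s = 0"
      by (rule eventually_mono[OF eventually_conj[OF ev[OF d(1)] F(2)]]) (use Fz in auto)
    with assms(2) show False by contradiction
  qed
  obtain g r k where g: "0 < k" "0 < r" "g holomorphic_on ball (of_real t) r"
      "\<And>w. w \<in> ball (of_real t) r \<Longrightarrow> F w = (w - of_real t) ^ k * g w"
      "\<And>w. w \<in> ball (of_real t) r \<Longrightarrow> g w \<noteq> 0"
    by (rule holomorphic_factor_zero_nonconstant[OF d(2) _ _ _ F0 nc]) (use d(1) in auto)
  show ?thesis
  proof (rule that[of "\<lambda>s. g (of_real s)" k])
    have "g analytic_on {of_real t}"
      using g(2,3) analytic_at_ball by blast
    then show "real_analytic_at (\<lambda>s. g (of_real s)) t"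
      unfolding real_analytic_at_iff_analytic_extension by auto
    show "g (of_real t) \<noteq> 0" using g(2,5) by simp
    show "\<forall>\<^sub>F s in nhds t. f s = (s - t) ^ k *\<^sub>R g (of_real s)"
      using F(2) ev[OF g(2)]
      by eventually_elim (simp add: g(4) scaleR_conv_of_real)
  qed
qed

lemma eventually_nonzero_isCont:
  fixes f :: "real \<Rightarrow> 'b::{t1_space,zero}"
  assumes "isCont f t" "f t \<noteq> 0"
  shows "\<forall>\<^sub>F s in nhds t. f s \<noteq> 0"
proof -
  have "\<forall>\<^sub>F s in at t. f s \<noteq> 0"
    using assms by (intro tendsto_imp_eventually_ne[where c = "f t"]) (auto simp: isCont_def)
  then show ?thesis
    using assms(2) by (auto simp: eventually_nhds_conv_at)
qed

lemma real_analytic_at_eventually_nonzero: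
  fixes f :: "real \<Rightarrow> complex"
  assumes "real_analytic_at f t" "\<not> (\<forall>\<^sub>F s in nhds t. f s = 0)"
  shows "\<forall>\<^sub>F s in at t. f s \<noteq> 0"
proof -
  obtain k h where h: "real_analytic_at h t" "h t \<noteq> 0" "\<forall>\<^sub>F s in nhds t. f s = (s - t) ^ k *\<^sub>R h s"
    using real_analytic_at_factor[OF assms] .
  have "\<forall>\<^sub>F s in nhds t. h s \<noteq> 0"
    by (rule eventually_nonzero_isCont) (use h real_analytic_at_imp_continuous in auto)
  with h(3) have "\<forall>\<^sub>F s in nhds t. s \<noteq> t \<longrightarrow> f s \<noteq> 0"
    by eventually_elim simp
  then show ?thesis by (simp add: eventually_at_filter)
qed

text \<open>Otherwise \<open>g\<close> would be \<open>(s - t)\<close> to a positive power times \<open>h\<close> near \<open>t\<close>, and would vanish at \<open>t\<close>.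
This makes the order of vanishing well defined.\<close>

lemma factor_exponent_le:
  fixes g h :: "real \<Rightarrow> complex"
  assumes "isCont g t" "isCont h t" "g t \<noteq> 0"
    and "\<forall>\<^sub>F s in nhds t. (s - t) ^ k *\<^sub>R g s = (s - t) ^ l *\<^sub>R h s"
  shows "l \<le> k"
proof (rule ccontr)
  assume "\<not> l \<le> k"
  then obtain m where l: "l = k + Suc m"
    by (metis less_imp_Suc_add add_Suc_right not_le)
  have "g s = (s - t) ^ Suc m *\<^sub>R h s"
    if "s \<noteq> t" "(s - t) ^ k *\<^sub>R g s = (s - t) ^ l *\<^sub>R h s" for s
  proof -
    have "(s - t) ^ k *\<^sub>R g s = (s - t) ^ k *\<^sub>R ((s - t) ^ Suc m *\<^sub>R h s)"
      using that(2) by (simp only: l power_add scaleR_scaleR)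
    then show ?thesis using that(1) by (simp only: scaleR_cancel_left) simp
  qed
  then have "\<forall>\<^sub>F s in at t. g s = (s - t) ^ Suc m *\<^sub>R h s"
    using assms(4) unfolding eventually_at_filter by (auto elim!: eventually_mono)
  moreover have "((\<lambda>s. (s - t) ^ Suc m *\<^sub>R h s) \<longlongrightarrow> (t - t) ^ Suc m *\<^sub>R h t) (at t)"
    using assms(2) unfolding isCont_def by (intro tendsto_intros)
  ultimately have "(g \<longlongrightarrow> 0) (at t)"
    by (simp add: tendsto_cong)
  moreover have "(g \<longlongrightarrow> g t) (at t)"
    using assms(1) unfolding isCont_def .
  ultimately show False
    using assms(3) tendsto_unique[OF trivial_limit_at] by blast
qed

lemma vanishing_order_eqI:
  fixes f h :: "real \<Rightarrow> complex"
  assumes "real_analytic_at h t" "h t \<noteq> 0" "\<forall>\<^sub>F s in nhds t. f s = (s - t) ^ k *\<^sub>R h s"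
  shows "vanishing_order f t = enat k"
proof -
  have nz: "\<forall>\<^sub>F s in nhds t. h s \<noteq> 0"
    by (rule eventually_nonzero_isCont) (use assms real_analytic_at_imp_continuous in auto)
  have "\<not> (\<forall>\<^sub>F s in nhds t. f s = 0)"
  proof
    assume "\<forall>\<^sub>F s in nhds t. f s = 0"
    with nz assms(3) have "\<forall>\<^sub>F s in nhds t. s = t"
      by eventually_elim (simp split: if_splits)
    then have "\<forall>\<^sub>F s in at t. False"
      by (auto simp: eventually_at_filter elim: eventually_mono)
    then show False by simp
  qed
  moreover have "(THE k. \<exists>h. real_analytic_at h t \<and> h t \<noteq> 0 \<and>
      (\<forall>\<^sub>F s in nhds t. f s = (s - t) ^ k *\<^sub>R h s)) = k"
  proof (rule the_equality)
    fix l assume "\<exists>h. real_analytic_at h t \<and> h t \<noteq> 0 \<and> (\<forall>\<^sub>F s in nhds t. f s = (s - t) ^ l *\<^sub>R h s)"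
    then obtain g where g: "real_analytic_at g t" "g t \<noteq> 0" "\<forall>\<^sub>F s in nhds t. f s = (s - t) ^ l *\<^sub>R g s"
      by blast
    have eq: "\<forall>\<^sub>F s in nhds t. (s - t) ^ k *\<^sub>R h s = (s - t) ^ l *\<^sub>R g s"
      using assms(3) g(3) by eventually_elim simp
    then have eq': "\<forall>\<^sub>F s in nhds t. (s - t) ^ l *\<^sub>R g s = (s - t) ^ k *\<^sub>R h s"
      by eventually_elim simp
    show "l = k"
      using factor_exponent_le[OF _ _ _ eq] factor_exponent_le[OF _ _ _ eq'] assms(1,2) g(1,2)
      by (simp add: real_analytic_at_imp_continuous le_antisym)
  qed (use assms in blast)
  ultimately show ?thesis by (simp add: vanishing_order_def)
qed

text \<open>Dividing \<open>(s - t)\<^sup>k j(s)\<close> by \<open>(s - t)\<^sup>k h(s)\<close> cancels the zero at \<open>t\<close>: this removable singularity is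
where compatibility enters the proof.\<close>

lemma vanishing_order_eq_imp_quotient:
  fixes f g :: "real \<Rightarrow> complex"
  assumes "real_analytic_at f t" "real_analytic_at g t"
    and eq: "vanishing_order f t = vanishing_order g t" and fin: "vanishing_order f t < \<infinity>"
  obtains u where "real_analytic_at u t" "u t \<noteq> 0" "\<forall>\<^sub>F s in nhds t. g s = u s * f s"
    "\<forall>\<^sub>F s in at t. f s \<noteq> 0"
proof -
  have nf: "\<not> (\<forall>\<^sub>F s in nhds t. f s = 0)" and ng: "\<not> (\<forall>\<^sub>F s in nhds t. g s = 0)"
    using eq fin by (auto simp: vanishing_order_def)
  obtain k h where h: "real_analytic_at h t" "h t \<noteq> 0" "\<forall>\<^sub>F s in nhds t. f s = (s - t) ^ k *\<^sub>R h s"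
    using real_analytic_at_factor[OF assms(1) nf] .
  obtain l j where j: "real_analytic_at j t" "j t \<noteq> 0" "\<forall>\<^sub>F s in nhds t. g s = (s - t) ^ l *\<^sub>R j s"
    using real_analytic_at_factor[OF assms(2) ng] .
  have kl: "k = l"
    using eq vanishing_order_eqI[OF h] vanishing_order_eqI[OF j] by simp
  have nz: "\<forall>\<^sub>F s in nhds t. h s \<noteq> 0"
    by (rule eventually_nonzero_isCont) (use h real_analytic_at_imp_continuous in auto)
  show ?thesis
  proof (rule that[of "\<lambda>s. j s / h s"])
    show "real_analytic_at (\<lambda>s. j s / h s) t"
      using h j by (intro real_analytic_intros)
    show "\<forall>\<^sub>F s in nhds t. g s = j s / h s * f s"
      using h(3) j(3) nz by eventually_elim (simp add: kl)
  qed (use h j real_analytic_at_eventually_nonzero[OF assms(1) nf] in auto)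
qed

lemma vanishing_order_mult_unit:
  fixes f g u :: "real \<Rightarrow> complex"
  assumes "real_analytic_at f t" "real_analytic_at u t" "u t \<noteq> 0"
    and g: "\<forall>\<^sub>F s in nhds t. g s = u s * f s" and nf: "\<not> (\<forall>\<^sub>F s in nhds t. f s = 0)"
  shows "vanishing_order f t = vanishing_order g t" "vanishing_order f t < \<infinity>"
proof -
  obtain k h where h: "real_analytic_at h t" "h t \<noteq> 0" "\<forall>\<^sub>F s in nhds t. f s = (s - t) ^ k *\<^sub>R h s"
    using real_analytic_at_factor[OF assms(1) nf] .
  have "\<forall>\<^sub>F s in nhds t. g s = (s - t) ^ k *\<^sub>R (u s * h s)"
    using g h(3) by eventually_elim simp
  then have "vanishing_order g t = enat k"
    by (intro vanishing_order_eqI[of "\<lambda>s. u s * h s"]) (use h assms in \<open>auto intro: real_analytic_intros\<close>)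
  with vanishing_order_eqI[OF h]
  show "vanishing_order f t = vanishing_order g t" "vanishing_order f t < \<infinity>" by auto
qed

lemma continuous_eq_at_limit:
  fixes f g :: "real \<Rightarrow> 'b::t2_space"
  assumes "isCont f t" "isCont g t" "\<forall>\<^sub>F s in at t. f s = g s"
  shows "f t = g t"
proof (rule tendsto_unique[OF trivial_limit_at])
  show "(f \<longlongrightarrow> f t) (at t)" using assms(1) unfolding isCont_def .
  show "(f \<longlongrightarrow> g t) (at t)"
    using assms(2) unfolding isCont_def tendsto_cong[OF assms(3)] .
qed

lemma exp_Ln_divide_of_real:
  assumes "0 < x"
  shows "exp (Ln (of_real x) / of_nat n) = of_real (exp (ln x / real n))"
proof -
  have "Ln (of_real x) / of_nat n = of_real (ln x / real n)"
    using assms by (simp add: Ln_of_real)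
  then show ?thesis by (simp only: exp_of_real)
qed

lemma eventually_nhds_imp_at: "eventually P (nhds t) \<Longrightarrow> eventually P (at t)"
  by (auto simp: eventually_at_filter elim: eventually_mono)

section \<open>Vectors and matrices depending analytically on a parameter\<close>

lemma real_analytic_at_vec_iff:
  fixes f :: "real \<Rightarrow> 'b::real_normed_vector ^ 'n"
  shows "real_analytic_at f t \<longleftrightarrow> (\<forall>i. real_analytic_at (\<lambda>s. f s $ i) t)"
proof
  assume "real_analytic_at f t"
  then show "\<forall>i. real_analytic_at (\<lambda>s. f s $ i) t"
    by (auto intro: real_analytic_at_bounded_linear[OF bounded_linear_vec_nth])
next
  assume "\<forall>i. real_analytic_at (\<lambda>s. f s $ i) t"
  then obtain a r where r: "\<And>i. 0 < r i"
    and a: "\<And>i s. \<bar>s - t\<bar> < r i \<Longrightarrow> (\<lambda>k. (s - t) ^ k *\<^sub>R a i k) sums (f s $ i)"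
    unfolding real_analytic_at_def by metis
  have "(\<lambda>k. (s - t) ^ k *\<^sub>R (\<chi> i. a i k)) sums f s" if "\<bar>s - t\<bar> < Min (range r)" for s
    unfolding sums_def
  proof (rule vec_tendstoI)
    fix i
    have "\<bar>s - t\<bar> < r i" using that by simp
    from a[OF this]
    show "(\<lambda>n. (\<Sum>k<n. (s - t) ^ k *\<^sub>R (\<chi> i. a i k)) $ i) \<longlonglongrightarrow> f s $ i"
      by (simp add: sums_def)
  qed
  moreover have "0 < Min (range r)" using r by simp
  ultimately show "real_analytic_at f t"
    unfolding real_analytic_at_def
    by (intro exI[of _ "\<lambda>k. \<chi> i. a i k"] exI[of _ "Min (range r)"]) blast
qed

lemma real_analytic_at_matrix_iff:
  fixes A :: "real \<Rightarrow> complex ^ 'n ^ 'm"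
  shows "real_analytic_at A t \<longleftrightarrow> (\<forall>i j. real_analytic_at (\<lambda>s. A s $ i $ j) t)"
  by (simp add: real_analytic_at_vec_iff)

lemma real_analytic_at_component:
  fixes A :: "real \<Rightarrow> complex ^ 'n ^ 'm"
  shows "real_analytic_at A t \<Longrightarrow> real_analytic_at (\<lambda>s. A s $ i $ j) t"
  by (simp add: real_analytic_at_matrix_iff)

lemma real_analytic_at_matrix_continuous:
  fixes A :: "real \<Rightarrow> complex ^ 'n ^ 'm"
  assumes "real_analytic_at A t"
  shows "isCont A t"
  unfolding isCont_def
  by (intro vec_tendstoI)
    (use assms real_analytic_at_imp_continuous in \<open>auto simp: real_analytic_at_matrix_iff isCont_def\<close>)

lemma real_analytic_at_matrix_mult [real_analytic_intros]:
  fixes A :: "real \<Rightarrow> complex ^ 'n ^ 'm" and B :: "real \<Rightarrow> complex ^ 'l ^ 'n"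
  shows "real_analytic_at A t \<Longrightarrow> real_analytic_at B t \<Longrightarrow> real_analytic_at (\<lambda>s. A s ** B s) t"
  by (auto simp: real_analytic_at_matrix_iff matrix_matrix_mult_def intro!: real_analytic_intros)

lemma real_analytic_at_conj_transpose [real_analytic_intros]:
  fixes A :: "real \<Rightarrow> complex ^ 'n ^ 'm"
  shows "real_analytic_at A t \<Longrightarrow> real_analytic_at (\<lambda>s. conj_transpose (A s)) t"
  by (auto simp: real_analytic_at_matrix_iff conj_transpose_def intro!: real_analytic_intros)

lemma real_analytic_at_det [real_analytic_intros]:
  fixes A :: "real \<Rightarrow> complex ^ 'n ^ 'n"
  shows "real_analytic_at A t \<Longrightarrow> real_analytic_at (\<lambda>s. det (A s)) t"
  by (auto simp: real_analytic_at_matrix_iff det_def intro!: real_analytic_intros)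

lemma matrix_inv_inverse:
  fixes A :: "complex ^ 'n ^ 'n"
  assumes "det A \<noteq> 0"
  shows "A ** matrix_inv A = mat 1" "matrix_inv A ** A = mat 1"
proof -
  have "\<exists>B. A ** B = mat 1 \<and> B ** A = mat 1"
    using assms invertible_det_nz unfolding invertible_def by blast
  then have "A ** matrix_inv A = mat 1 \<and> matrix_inv A ** A = mat 1"
    unfolding matrix_inv_def by (rule someI_ex)
  then show "A ** matrix_inv A = mat 1" "matrix_inv A ** A = mat 1" by auto
qed

text \<open>Cramer's rule for the columns of the inverse; it shows that inversion is polynomial on \<open>SL\<close> and so
preserves analyticity.\<close>

lemma matrix_inv_cramer:
  fixes A :: "complex ^ 'n ^ 'n"
  assumes "det A \<noteq> 0"
  shows "matrix_inv A $ k $ j = det (\<chi> i l. if l = k then axis j 1 $ i else A $ i $ l) / det A"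
proof -
  have "A ** matrix_inv A = mat 1"
    using assms by (rule matrix_inv_inverse)
  then have "A *v (matrix_inv A *v axis j 1) = axis j 1"
    by (simp add: matrix_vector_mul_assoc)
  then have "matrix_inv A *v axis j 1 =
      (\<chi> k. det (\<chi> i l. if l = k then axis j 1 $ i else A $ i $ l) / det A)"
    unfolding cramer[OF assms] .
  then have "(matrix_inv A *v axis j 1) $ k =
      det (\<chi> i l. if l = k then axis j 1 $ i else A $ i $ l) / det A"
    by simp
  moreover have "(matrix_inv A *v axis j 1) $ k = matrix_inv A $ k $ j"
    by (simp add: matrix_vector_mult_def axis_def if_distrib cong: if_cong)
  ultimately show ?thesis by simp
qed

lemma real_analytic_at_matrix_inv [real_analytic_intros]:
  fixes A :: "real \<Rightarrow> complex ^ 'n ^ 'n"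
  assumes A: "real_analytic_at A t" and det: "\<forall>\<^sub>F s in nhds t. A s \<in> SL"
  shows "real_analytic_at (\<lambda>s. matrix_inv (A s)) t"
proof -
  have "real_analytic_at (\<lambda>s. matrix_inv (A s) $ k $ j) t" for k j
  proof -
    have "\<forall>\<^sub>F s in nhds t. matrix_inv (A s) $ k $ j =
        det (\<chi> i l. if l = k then axis j 1 $ i else A s $ i $ l)"
      using det by eventually_elim (simp add: matrix_inv_cramer SL_def)
    moreover have "real_analytic_at (\<lambda>s. det (\<chi> i l. if l = k then axis j 1 $ i else A s $ i $ l)) t"
    proof (rule real_analytic_at_det, unfold real_analytic_at_matrix_iff, intro allI)
      fix i l
      show "real_analytic_at (\<lambda>s. (\<chi> i l. if l = k then axis j 1 $ i else A s $ i $ l) $ i $ l) t"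
        using A by (cases "l = k") (auto simp: real_analytic_at_matrix_iff intro: real_analytic_intros)
    qed
    ultimately show ?thesis by (simp add: real_analytic_at_cong)
  qed
  then show ?thesis by (simp add: real_analytic_at_matrix_iff)
qed

section \<open>Invariant positive definite forms\<close>

lemma conj_transpose_nth [simp]: "conj_transpose A $ i $ j = cnj (A $ j $ i)"
  by (simp add: conj_transpose_def)

lemma conj_transpose_mult: "conj_transpose (A ** B) = conj_transpose B ** conj_transpose A"
  by (simp add: vec_eq_iff matrix_matrix_mult_def mult.commute)

lemma conj_transpose_mat_1 [simp]: "conj_transpose (mat 1) = mat 1"
  by (simp add: vec_eq_iff mat_def)

lemma det_conj_transpose: "det (conj_transpose A) = cnj (det A)"
proof -
  have "conj_transpose A = transpose (\<chi> i j. cnj (A $ i $ j))"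
    by (simp add: vec_eq_iff transpose_def)
  then have "det (conj_transpose A) = det (\<chi> i j. cnj (A $ i $ j))"
    by (simp only: det_transpose)
  also have "\<dots> = cnj (det A)"
    by (simp add: det_def)
  finally show ?thesis .
qed

lemma SL_mult: "A \<in> SL \<Longrightarrow> B \<in> SL \<Longrightarrow> A ** B \<in> SL"
  by (simp add: SL_def det_mul)

lemma SL_conj_transpose: "A \<in> SL \<Longrightarrow> conj_transpose A \<in> SL"
  by (simp add: SL_def det_conj_transpose)

lemma SL_inverse:
  assumes "A \<in> SL"
  shows "A ** matrix_inv A = mat 1" "matrix_inv A ** A = mat 1"
    "A ** (matrix_inv A ** B) = B" "matrix_inv A ** (A ** B) = B"
  using matrix_inv_inverse[of A] assms by (simp_all add: SL_def matrix_mul_assoc)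

lemma SL_matrix_inv:
  assumes "A \<in> SL"
  shows "matrix_inv A \<in> SL"
proof -
  have "det A * det (matrix_inv A) = 1"
    using SL_inverse(1)[OF assms] by (metis det_I det_mul)
  with assms show ?thesis by (simp add: SL_def)
qed

lemma SL_conjugate_by: "V \<in> SL \<Longrightarrow> A \<in> SL \<Longrightarrow> conjugate_by V A \<in> SL"
  by (simp add: conjugate_by_def SL_mult SL_matrix_inv)

lemma conjugate_by_intertwines: "V \<in> SL \<Longrightarrow> conjugate_by V A ** V = V ** A"
  by (simp add: conjugate_by_def SL_inverse flip: matrix_mul_assoc)

lemma SL_cancel_left: "A \<in> SL \<Longrightarrow> A ** B = A ** B' \<Longrightarrow> B = B'"
  by (metis SL_inverse(4))

lemma SL_cancel_right:
  assumes "A \<in> SL" "B ** A = B' ** A"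
  shows "B = B'"
proof -
  have "B ** A ** matrix_inv A = B' ** A ** matrix_inv A" using assms(2) by simp
  then show ?thesis using assms(1) by (simp add: SL_inverse flip: matrix_mul_assoc)
qed

text \<open>The positive definite hermitian matrices of determinant one are the products \<open>V\<^sup>* V\<close> with \<open>V \<in> SL\<close>.
Stating them in this way ties forms directly to unitarizers; \<open>invariant_forms {}\<close> is the set of all
of them.\<close>

definition invariant_forms :: "(complex ^ 'n ^ 'n) set \<Rightarrow> (complex ^ 'n ^ 'n) set" where
  "invariant_forms \<N> =
     {H. (\<exists>V\<in>SL. H = conj_transpose V ** V) \<and> (\<forall>N\<in>\<N>. conj_transpose N ** H ** N = H)}"

text \<open>With \<open>U = V N V\<inverse>\<close> one has \<open>N\<^sup>* (V\<^sup>* V) N = (U V)\<^sup>* (U V) = V\<^sup>* (U\<^sup>* U) V\<close>, and \<open>V\<close> can be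
cancelled.\<close>

lemma conjugate_by_in_SU_iff:
  assumes V: "V \<in> SL" and N: "N \<in> SL"
  shows "conjugate_by V N \<in> SU \<longleftrightarrow>
    conj_transpose N ** (conj_transpose V ** V) ** N = conj_transpose V ** V"
proof -
  let ?U = "conjugate_by V N"
  have "conj_transpose N ** (conj_transpose V ** V) ** N = conj_transpose (V ** N) ** (V ** N)"
    by (simp add: conj_transpose_mult matrix_mul_assoc)
  also have "\<dots> = conj_transpose V ** ((conj_transpose ?U ** ?U) ** V)"
    by (simp add: conj_transpose_mult matrix_mul_assoc flip: conjugate_by_intertwines[OF V])
  finally have eq: "conj_transpose N ** (conj_transpose V ** V) ** N =
      conj_transpose V ** ((conj_transpose ?U ** ?U) ** V)" .
  have "?U \<in> SU \<longleftrightarrow> conj_transpose ?U ** ?U = mat 1"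
    using SL_conjugate_by[OF V N] by (simp add: SU_def SL_def)
  also have "\<dots> \<longleftrightarrow> conj_transpose V ** ((conj_transpose ?U ** ?U) ** V) = conj_transpose V ** V"
    (is "_ \<longleftrightarrow> ?E")
  proof
    assume ?E
    then have "(conj_transpose ?U ** ?U) ** V = mat 1 ** V"
      using SL_cancel_left[OF SL_conj_transpose[OF V]] by simp
    then show "conj_transpose ?U ** ?U = mat 1"
      by (rule SL_cancel_right[OF V])
  qed simp
  finally show ?thesis by (simp only: eq)
qed

text \<open>Pulling a form back along \<open>B\<close>. Both directions of a change of basis are instances, with \<open>B\<close> the
basis change or its inverse.\<close>

lemma invariant_forms_transport:
  assumes B: "B \<in> SL" and H: "H \<in> invariant_forms \<N>"
    and inter: "\<And>N'. N' \<in> \<N>' \<Longrightarrow> \<exists>N\<in>\<N>. B ** N' = N ** B"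
  shows "conj_transpose B ** H ** B \<in> invariant_forms \<N>'"
proof -
  obtain V where V: "V \<in> SL" "H = conj_transpose V ** V"
    and inv: "\<And>N. N \<in> \<N> \<Longrightarrow> conj_transpose N ** H ** N = H"
    using H by (auto simp: invariant_forms_def)
  have "conj_transpose B ** H ** B = conj_transpose (V ** B) ** (V ** B)"
    by (simp add: V(2) conj_transpose_mult matrix_mul_assoc)
  moreover have "V ** B \<in> SL" using V(1) B by (rule SL_mult)
  moreover have "conj_transpose N' ** (conj_transpose B ** H ** B) ** N' = conj_transpose B ** H ** B"
    if "N' \<in> \<N>'" for N'
  proof -
    obtain N where N: "N \<in> \<N>" "B ** N' = N ** B" using inter[OF \<open>N' \<in> \<N>'\<close>] by blast
    have "conj_transpose N' ** (conj_transpose B ** H ** B) ** N' =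
        conj_transpose (B ** N') ** H ** (B ** N')"
      by (simp add: conj_transpose_mult matrix_mul_assoc)
    also have "\<dots> = conj_transpose B ** (conj_transpose N ** H ** N) ** B"
      unfolding N(2) by (simp add: conj_transpose_mult matrix_mul_assoc)
    finally show ?thesis by (simp add: inv[OF N(1)])
  qed
  ultimately show ?thesis by (auto simp: invariant_forms_def)
qed

lemma invariant_forms_to_conjugates:
  assumes C: "C \<in> SL" and H: "H \<in> invariant_forms \<N>"
  shows "conj_transpose (matrix_inv C) ** H ** matrix_inv C \<in> invariant_forms (conjugate_by C ` \<N>)"
  by (rule invariant_forms_transport[OF SL_matrix_inv[OF C] H])
    (auto simp: conjugate_by_def SL_inverse[OF C] simp flip: matrix_mul_assoc)

lemma invariant_forms_from_conjugates:
  assumes C: "C \<in> SL" and H: "H \<in> invariant_forms (conjugate_by C ` \<N>)"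
  shows "conj_transpose C ** H ** C \<in> invariant_forms \<N>"
  by (rule invariant_forms_transport[OF C H]) (auto simp: conjugate_by_intertwines[OF C])

lemma invariant_forms_antimono: "\<N>' \<subseteq> \<N> \<Longrightarrow> invariant_forms \<N> \<subseteq> invariant_forms \<N>'"
  by (auto simp: invariant_forms_def)

lemma conj_transpose_mult_self_diag:
  "(conj_transpose V ** V) $ i $ i = of_real (\<Sum>k\<in>UNIV. (cmod (V $ k $ i))\<^sup>2)"
  by (simp add: matrix_matrix_mult_def mult.commute flip: complex_norm_square)

lemma SL_column_nonzero:
  fixes V :: "complex ^ 'n ^ 'n"
  assumes "V \<in> SL" shows "\<exists>k. V $ k $ i \<noteq> 0"
proof (rule ccontr)
  assume "\<not> ?thesis"
  then have "column i V = 0" by (simp add: column_def vec_eq_iff)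
  then have "det V = 0" by (rule det_zero_column)
  with assms show False by (simp add: SL_def)
qed

lemma invariant_form_diag_pos:
  assumes "H \<in> invariant_forms \<N>"
  obtains x where "0 < x" "H $ i $ i = of_real x"
proof -
  obtain V where V: "V \<in> SL" "H = conj_transpose V ** V"
    using assms by (auto simp: invariant_forms_def)
  obtain k where "V $ k $ i \<noteq> 0" using SL_column_nonzero[OF V(1)] by blast
  then have "0 < (\<Sum>k\<in>UNIV. (cmod (V $ k $ i))\<^sup>2)"
    by (intro sum_pos2[of _ k]) auto
  with that show thesis by (simp add: V(2) conj_transpose_mult_self_diag)
qed

lemma invariant_form_det:
  assumes "H \<in> invariant_forms \<N>" shows "det H = 1"
  using assms by (auto simp: invariant_forms_def det_mul det_conj_transpose SL_def)

lemma diagonal_mult_nth: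
  assumes "is_diagonal D"
  shows "(D ** A) $ i $ j = D $ i $ i * A $ i $ j" "(A ** D) $ i $ j = A $ i $ j * D $ j $ j"
proof -
  have "(D ** A) $ i $ j = (\<Sum>k\<in>UNIV. if k = i then D $ i $ i * A $ i $ j else 0)"
    unfolding matrix_matrix_mult_def vec_lambda_beta
    by (rule sum.cong) (use assms in \<open>auto simp: is_diagonal_def\<close>)
  then show "(D ** A) $ i $ j = D $ i $ i * A $ i $ j" by simp
  have "(A ** D) $ i $ j = (\<Sum>k\<in>UNIV. if k = j then A $ i $ j * D $ j $ j else 0)"
    unfolding matrix_matrix_mult_def vec_lambda_beta
    by (rule sum.cong) (use assms in \<open>auto simp: is_diagonal_def\<close>)
  then show "(A ** D) $ i $ j = A $ i $ j * D $ j $ j" by simp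
qed

lemma is_diagonal_conj_transpose: "is_diagonal D \<Longrightarrow> is_diagonal (conj_transpose D)"
  by (simp add: is_diagonal_def)

text \<open>Entrywise, invariance under \<open>D = diag(d\<^sub>1, \<dots>, d\<^sub>n)\<close> says that \<open>H\<^sub>i\<^sub>j\<close> equals the conjugate of \<open>d\<^sub>i\<close>
times \<open>H\<^sub>i\<^sub>j d\<^sub>j\<close>. The diagonal entries of \<open>H\<close> are nonzero, so all \<open>d\<^sub>i\<close> are unimodular, and the
equation becomes \<open>(d\<^sub>j - d\<^sub>i) H\<^sub>i\<^sub>j = 0\<close>.\<close>

lemma invariant_form_diagonal:
  assumes H: "H \<in> invariant_forms \<N>" and D: "D \<in> \<N>" "is_diagonal D"
    and distinct: "\<And>i j. i \<noteq> j \<Longrightarrow> D $ i $ i \<noteq> D $ j $ j"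
  shows "is_diagonal H"
  unfolding is_diagonal_def
proof (intro allI impI)
  fix i j :: 'a assume "i \<noteq> j"
  have eq: "cnj (D $ i $ i) * H $ i $ j * D $ j $ j = H $ i $ j" for i j
  proof -
    have "(conj_transpose D ** H ** D) $ i $ j = H $ i $ j"
      using H D(1) by (auto simp: invariant_forms_def)
    then show ?thesis
      by (simp add: diagonal_mult_nth D(2) is_diagonal_conj_transpose)
  qed
  have "H $ i $ i \<noteq> 0"
    using invariant_form_diag_pos[OF H, of i] by fastforce
  then have unimodular: "D $ i $ i * cnj (D $ i $ i) = 1"
    using eq[of i i] by (simp add: mult.commute mult.left_commute)
  have "D $ i $ i * (cnj (D $ i $ i) * H $ i $ j * D $ j $ j) = D $ i $ i * H $ i $ j"
    by (simp only: eq)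
  then have "D $ j $ j * H $ i $ j = D $ i $ i * H $ i $ j"
    using unimodular by (metis mult.assoc mult.commute mult_1)
  then show "H $ i $ j = 0"
    using distinct[OF \<open>i \<noteq> j\<close>] by simp
qed

text \<open>Invariance \<open>P\<^sup>* H P = H\<close> rewritten as \<open>H P = R H\<close> with \<open>R = (P\<^sup>*)\<inverse>\<close>, and read entrywise.\<close>

lemma diagonal_invariant_form_ratio:
  assumes H: "H \<in> invariant_forms \<N>" and P: "P \<in> \<N>" "P \<in> SL" and diag: "is_diagonal H"
  shows "H $ i $ i * P $ i $ j = matrix_inv (conj_transpose P) $ i $ j * H $ j $ j"
proof -
  have "matrix_inv (conj_transpose P) ** H =
      matrix_inv (conj_transpose P) ** (conj_transpose P ** (H ** P))"
    using H P(1) by (auto simp: invariant_forms_def matrix_mul_assoc)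
  also have "\<dots> = H ** P"
    by (simp add: SL_inverse SL_conj_transpose P(2))
  finally have "(matrix_inv (conj_transpose P) ** H) $ i $ j = (H ** P) $ i $ j" by simp
  then show ?thesis by (simp add: diagonal_mult_nth diag)
qed

text \<open>If the graph of nonzero entries of \<open>P = C B C\<inverse>\<close> has a vertex \<open>a\<close> whose component \<open>S\<close> is not
everything, the vectors whose \<open>S\<close>-coordinates vanish form a proper nonzero subspace. It is invariant
under \<open>P\<close>, as no entry links \<open>S\<close> to its complement, and under every diagonal matrix.\<close>

lemma irreducible_imp_connected_graph:
  fixes A B C :: "complex ^ 'n ^ 'n"
  assumes irr: "\<not> reducible_pair A B" and C: "C \<in> SL"
    and diag: "is_diagonal (conjugate_by C A)"
  shows "connected_graph {(i, j). conjugate_by C B $ i $ j \<noteq> 0}"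
proof (rule ccontr)
  let ?P = "conjugate_by C B" and ?D = "conjugate_by C A"
  let ?G = "{(i, j). ?P $ i $ j \<noteq> 0}"
  assume "\<not> connected_graph ?G"
  then obtain a b where ab: "(a, b) \<notin> (?G \<union> ?G\<inverse>)\<^sup>*"
    unfolding connected_graph_def by (metis (no_types, lifting) UNIV_eq_I surj_pair)
  define S where "S = {i. (a, i) \<in> (?G \<union> ?G\<inverse>)\<^sup>*}"
  define W where "W = {x. \<forall>i\<in>S. (C *v x) $ i = 0}"
  have aS: "a \<in> S" and bS: "b \<notin> S" using ab by (auto simp: S_def)
  have CC: "C *v (matrix_inv C *v x) = x" for x
    by (simp add: matrix_vector_mul_assoc SL_inverse[OF C])
  have row_zero: "(N *v y) $ i = 0" if "\<And>j. N $ i $ j * y $ j = 0"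
    for N :: "complex ^ 'n ^ 'n" and y i
    unfolding matrix_vector_mult_def vec_lambda_beta by (rule sum.neutral) (use that in blast)
  have "vec.subspace W"
    unfolding vec.subspace_def W_def
    by (auto simp: matrix_vector_right_distrib vec.scale matrix_vector_mult_scaleR)
  moreover have "W \<noteq> {0}"
  proof
    assume "W = {0}"
    moreover have "matrix_inv C *v axis b 1 \<in> W"
      using bS by (auto simp: W_def CC axis_def)
    ultimately have "C *v (matrix_inv C *v axis b 1) = 0" by simp
    then show False by (simp add: CC)
  qed
  moreover have "W \<noteq> UNIV"
  proof
    assume "W = UNIV"
    then have "matrix_inv C *v axis a 1 \<in> W" by simp
    then show False using aS by (auto simp: W_def CC axis_def)
  qed
  moreover have "(*v) A ` W \<subseteq> W"
  proof safe
    fix x assume x: "x \<in> W"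
    have "C *v (A *v x) = ?D *v (C *v x)"
      by (simp add: matrix_vector_mul_assoc conjugate_by_intertwines[OF C])
    moreover have "?D $ i $ j * (C *v x) $ j = 0" if "i \<in> S" for i j
      using x diag that by (cases "i = j") (auto simp: W_def is_diagonal_def)
    ultimately show "A *v x \<in> W"
      using row_zero by (simp add: W_def)
  qed
  moreover have "(*v) B ` W \<subseteq> W"
  proof safe
    fix x assume x: "x \<in> W"
    have "C *v (B *v x) = ?P *v (C *v x)"
      by (simp add: matrix_vector_mul_assoc conjugate_by_intertwines[OF C])
    moreover have "?P $ i $ j * (C *v x) $ j = 0" if i: "i \<in> S" for i j
    proof (cases "j \<in> S")
      case False
      have "(a, j) \<in> (?G \<union> ?G\<inverse>)\<^sup>*" if "?P $ i $ j \<noteq> 0"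
        using i that unfolding S_def by (auto intro: rtrancl_into_rtrancl)
      with False show ?thesis by (auto simp: S_def)
    qed (use x in \<open>auto simp: W_def\<close>)
    ultimately show "B *v x \<in> W"
      using row_zero by (simp add: W_def)
  qed
  ultimately show False using irr unfolding reducible_pair_def by blast
qed

definition diagonal_matrix :: "('n \<Rightarrow> complex) \<Rightarrow> complex ^ 'n ^ 'n" where
  "diagonal_matrix d = (\<chi> i j. if i = j then d i else 0)"

lemma diagonal_matrix_nth: "diagonal_matrix d $ i $ j = (if i = j then d i else 0)"
  by (simp add: diagonal_matrix_def)

lemma is_diagonal_diagonal_matrix: "is_diagonal (diagonal_matrix d)"
  by (simp add: is_diagonal_def diagonal_matrix_nth)

lemma is_diagonal_det: "is_diagonal A \<Longrightarrow> det A = (\<Prod>i\<in>UNIV. A $ i $ i)"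
  unfolding is_diagonal_def by (rule det_diagonal) auto

lemma positive_diagonal_is_gram:
  fixes y :: "'n::finite \<Rightarrow> real"
  assumes pos: "\<And>i. 0 < y i" and det: "det (diagonal_matrix (\<lambda>i. of_real (y i))) = 1"
  shows "\<exists>V\<in>SL. diagonal_matrix (\<lambda>i. of_real (y i)) = conj_transpose V ** V"
proof (rule bexI)
  let ?V = "diagonal_matrix (\<lambda>i. of_real (sqrt (y i)))"
  have "of_real (\<Prod>i\<in>UNIV. y i) = (1::complex)"
    using det by (simp add: is_diagonal_det is_diagonal_diagonal_matrix diagonal_matrix_nth)
  then have prod: "(\<Prod>i\<in>UNIV. y i) = 1" using of_real_eq_1_iff by blast
  have "(\<Prod>i\<in>UNIV. sqrt (y i))\<^sup>2 = (\<Prod>i\<in>UNIV. (sqrt (y i))\<^sup>2)"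
    by (simp add: prod_power_distrib)
  also have "\<dots> = 1" using pos by (simp add: prod less_imp_le)
  finally have "(\<Prod>i\<in>UNIV. sqrt (y i))\<^sup>2 = 1" .
  moreover have "0 < (\<Prod>i\<in>UNIV. sqrt (y i))"
    by (rule prod_pos) (use pos in simp)
  ultimately have "(\<Prod>i\<in>UNIV. sqrt (y i)) = 1"
    by (auto simp: power2_eq_1_iff)
  then have "(\<Prod>i\<in>UNIV. complex_of_real (sqrt (y i))) = 1"
    by (simp flip: of_real_prod)
  then show "?V \<in> SL"
    by (simp add: SL_def is_diagonal_det is_diagonal_diagonal_matrix diagonal_matrix_nth)
  have "of_real (sqrt (y i)) * of_real (sqrt (y i)) = complex_of_real (y i)" for i
    using pos[of i] by (simp flip: of_real_mult)
  then show "diagonal_matrix (\<lambda>i. of_real (y i)) = conj_transpose ?V ** ?V"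
    by (auto simp: vec_eq_iff diagonal_mult_nth(2)[OF is_diagonal_diagonal_matrix] diagonal_matrix_nth)
qed

section \<open>Invariant forms near a point\<close>

text \<open>Differences of eigenvalues are analytic and not identically zero, so the eigenvalues are distinct
in a punctured neighbourhood of \<open>t\<close>.\<close>

lemma eventually_invariant_forms_diagonal:
  fixes D :: "real \<Rightarrow> complex ^ 'n ^ 'n"
  assumes D: "real_analytic_at D t" and diag: "\<forall>\<^sub>F s in nhds t. is_diagonal (D s)"
    and distinct: "\<And>i j. i \<noteq> j \<Longrightarrow> \<not> (\<forall>\<^sub>F s in nhds t. D s $ i $ i = D s $ j $ j)"
  shows "\<forall>\<^sub>F s in at t. \<forall>\<N>. D s \<in> \<N> \<longrightarrow> (\<forall>H\<in>invariant_forms \<N>. is_diagonal H)"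
proof -
  have "\<forall>\<^sub>F s in at t. i \<noteq> j \<longrightarrow> D s $ i $ i \<noteq> D s $ j $ j" for i j
  proof (cases "i = j")
    case False
    have "\<forall>\<^sub>F s in at t. D s $ i $ i - D s $ j $ j \<noteq> 0"
      using distinct[OF False] D
      by (intro real_analytic_at_eventually_nonzero real_analytic_intros real_analytic_at_component) auto
    then show ?thesis by eventually_elim simp
  qed simp
  then have "\<forall>\<^sub>F s in at t. \<forall>i j. i \<noteq> j \<longrightarrow> D s $ i $ i \<noteq> D s $ j $ j"
    by (intro eventually_all_finite)
  with eventually_nhds_imp_at[OF diag] show ?thesis
  proof eventually_elim
    case (elim s)
    show ?case
    proof (intro allI impI ballI)
      fix \<N> H assume "D s \<in> \<N>" "H \<in> invariant_forms \<N>"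
      then show "is_diagonal H"
        by (intro invariant_form_diagonal[of H \<N> "D s"]) (use elim in auto)
    qed
  qed
qed

text \<open>The heart of the proof, in a basis where \<open>N\<^sub>a\<close> is diagonal. The relation \<open>h\<^sub>i = u h\<^sub>j\<close> with an analytic
unit \<open>u\<close> that does not depend on the form holds along the edges of \<open>G\<close> and is an equivalence
relation, hence it relates all indices. Its units \<open>u\<^sub>i\<^sub>j\<close> determine the form through
\<open>h\<^sub>i\<^sup>n = \<Prod>\<^sub>j u\<^sub>i\<^sub>j\<close>, and the conditions defining invariant forms pass to the limit \<open>s \<rightarrow> t\<close>.\<close>

lemma ex_analytic_invariant_form_diagonal:
  fixes N :: "'k \<Rightarrow> real \<Rightarrow> complex ^ 'n ^ 'n"
  assumes N_analytic: "\<And>k. k \<in> I \<Longrightarrow> real_analytic_at (N k) t"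
    and N_SL: "\<forall>\<^sub>F s in nhds t. \<forall>k\<in>I. N k s \<in> SL"
    and ab: "a \<in> I" "b \<in> I"
    and diag: "\<forall>\<^sub>F s in nhds t. is_diagonal (N a s)"
    and distinct: "\<And>i j. i \<noteq> j \<Longrightarrow> \<not> (\<forall>\<^sub>F s in nhds t. N a s $ i $ i = N a s $ j $ j)"
    and G: "connected_graph G"
    and compat: "\<And>i j. (i, j) \<in> G \<Longrightarrow>
      vanishing_order (\<lambda>s. N b s $ i $ j) t
        = vanishing_order (\<lambda>s. matrix_inv (conj_transpose (N b s)) $ i $ j) t \<and>
      vanishing_order (\<lambda>s. N b s $ i $ j) t < \<infinity>"
    and exist: "\<forall>\<^sub>F s in at t. invariant_forms ((\<lambda>k. N k s) ` I) \<noteq> {}"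
  shows "\<exists>Q. real_analytic_at Q t \<and>
    (\<forall>\<^sub>F s in nhds t. Q s \<in> invariant_forms ((\<lambda>k. N k s) ` I)) \<and>
    (\<forall>\<^sub>F s in at t. invariant_forms ((\<lambda>k. N k s) ` I) \<subseteq> {Q s})"
proof -
  let ?F = "\<lambda>s. invariant_forms ((\<lambda>k. N k s) ` I)"
  let ?R = "\<lambda>s. matrix_inv (conj_transpose (N b s))"
  note at = eventually_nhds_imp_at
  have Nb: "real_analytic_at (\<lambda>s. N b s $ i $ j) t" for i j
    using N_analytic[OF ab(2)] by (rule real_analytic_at_component)
  have b_SL: "\<forall>\<^sub>F s in nhds t. N b s \<in> SL"
    using N_SL ab(2) by (auto elim: eventually_mono)
  have "real_analytic_at ?R t"
    using N_analytic[OF ab(2)] b_SL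
    by (intro real_analytic_intros) (auto elim: eventually_mono intro: SL_conj_transpose)
  then have R: "real_analytic_at (\<lambda>s. ?R s $ i $ j) t" for i j
    by (rule real_analytic_at_component)

  have H_diag: "\<forall>\<^sub>F s in at t. \<forall>H\<in>?F s. is_diagonal H"
  proof (rule eventually_mono)
    show "\<forall>\<^sub>F s in at t. \<forall>\<N>. N a s \<in> \<N> \<longrightarrow> (\<forall>H\<in>invariant_forms \<N>. is_diagonal H)"
      by (rule eventually_invariant_forms_diagonal[OF N_analytic[OF ab(1)] diag distinct])
  next
    fix s assume "\<forall>\<N>. N a s \<in> \<N> \<longrightarrow> (\<forall>H\<in>invariant_forms \<N>. is_diagonal H)"
    from this[THEN spec, of "(\<lambda>k. N k s) ` I"] ab(1)
    show "\<forall>H\<in>?F s. is_diagonal H" by blast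
  qed

  define comparable where "comparable i j \<longleftrightarrow>
    (\<exists>u. real_analytic_at u t \<and> u t \<noteq> 0 \<and> (\<forall>\<^sub>F s in at t. \<forall>H\<in>?F s. H $ i $ i = u s * H $ j $ j))" for i j
  have sym: "comparable j i" if ij: "comparable i j" for i j
  proof -
    obtain u where u: "real_analytic_at u t" "u t \<noteq> 0"
      "\<forall>\<^sub>F s in at t. \<forall>H\<in>?F s. H $ i $ i = u s * H $ j $ j"
      using ij unfolding comparable_def by blast
    have "\<forall>\<^sub>F s in at t. u s \<noteq> 0"
      using u(1,2) by (intro at eventually_nonzero_isCont real_analytic_at_imp_continuous)
    with u(3) have "\<forall>\<^sub>F s in at t. \<forall>H\<in>?F s. H $ j $ j = 1 / u s * H $ i $ i"
      by eventually_elim simp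
    then show ?thesis
      unfolding comparable_def using u(1,2)
      by (intro exI[of _ "\<lambda>s. 1 / u s"]) (auto intro: real_analytic_intros)
  qed
  have trans: "comparable i k" if ij: "comparable i j" and jk: "comparable j k" for i j k
  proof -
    obtain u where u: "real_analytic_at u t" "u t \<noteq> 0"
      "\<forall>\<^sub>F s in at t. \<forall>H\<in>?F s. H $ i $ i = u s * H $ j $ j"
      using ij unfolding comparable_def by blast
    obtain v where v: "real_analytic_at v t" "v t \<noteq> 0"
      "\<forall>\<^sub>F s in at t. \<forall>H\<in>?F s. H $ j $ j = v s * H $ k $ k"
      using jk unfolding comparable_def by blast
    have "\<forall>\<^sub>F s in at t. \<forall>H\<in>?F s. H $ i $ i = (u s * v s) * H $ k $ k"
      using u(3) v(3) by eventually_elim (simp add: mult.assoc)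
    then show ?thesis
      unfolding comparable_def using u(1,2) v(1,2)
      by (intro exI[of _ "\<lambda>s. u s * v s"]) (auto intro: real_analytic_intros)
  qed
  have edge: "comparable i j" if ij: "(i, j) \<in> G" for i j
  proof -
    note compat_ij = conjunct1[OF compat[OF ij]] conjunct2[OF compat[OF ij]]
    obtain u where u: "real_analytic_at u t" "u t \<noteq> 0"
        "\<forall>\<^sub>F s in nhds t. ?R s $ i $ j = u s * N b s $ i $ j" "\<forall>\<^sub>F s in at t. N b s $ i $ j \<noteq> 0"
      by (rule vanishing_order_eq_imp_quotient[OF Nb R compat_ij])
    have "\<forall>\<^sub>F s in at t. \<forall>H\<in>?F s. H $ i $ i = u s * H $ j $ j"
      using at[OF u(3)] u(4) H_diag at[OF b_SL]
    proof eventually_elim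
      case (elim s)
      show ?case
      proof
        fix H assume H: "H \<in> ?F s"
        have "H $ i $ i * N b s $ i $ j = ?R s $ i $ j * H $ j $ j"
          using diagonal_invariant_form_ratio[OF H] ab(2) elim H by blast
        also have "\<dots> = (u s * H $ j $ j) * N b s $ i $ j" by (simp add: elim)
        finally show "H $ i $ i = u s * H $ j $ j" using elim(2) by simp
      qed
    qed
    with u(1,2) show ?thesis unfolding comparable_def by blast
  qed
  \<comment> \<open>Connectedness of the graph joins any two indices by a chain of edges.\<close>
  have comparable: "comparable i j" for i j
  proof -
    have "(i, j) \<in> (G \<union> G\<inverse>)\<^sup>*" using G by (simp add: connected_graph_def)
    then show ?thesis
    proof (induction rule: rtrancl_induct)
      case base
      show ?case
        unfolding comparable_def by (rule exI[of _ "\<lambda>_. 1"]) (auto intro: real_analytic_intros)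
    qed (use edge sym trans in blast)
  qed
  have "\<exists>u. \<forall>i j. real_analytic_at (u i j) t \<and> u i j t \<noteq> 0 \<and>
      (\<forall>\<^sub>F s in at t. \<forall>H\<in>?F s. H $ i $ i = u i j s * H $ j $ j)"
    by (intro choice allI) (rule comparable[unfolded comparable_def])
  then obtain u where u: "\<And>i j. real_analytic_at (u i j) t" "\<And>i j. u i j t \<noteq> 0"
    and u_ratio: "\<And>i j. \<forall>\<^sub>F s in at t. \<forall>H\<in>?F s. H $ i $ i = u i j s * H $ j $ j"
    by blast

  \<comment> \<open>On every form, \<open>w i\<close> is the \<open>n\<close>-th power of the diagonal entry \<open>h\<^sub>i\<close>, since \<open>\<Prod>h\<^sub>j = 1\<close>.\<close>
  define w where "w i s = (\<Prod>j\<in>UNIV. u i j s)" for i s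
  have w: "real_analytic_at (w i) t" for i
    unfolding w_def using u(1) by (auto intro: real_analytic_intros)
  have "\<forall>\<^sub>F s in at t. \<forall>i j. \<forall>H\<in>?F s. H $ i $ i = u i j s * H $ j $ j"
    using u_ratio by (intro eventually_all_finite)
  with H_diag have entries: "\<forall>\<^sub>F s in at t. \<forall>H\<in>?F s. \<forall>i.
      \<exists>x>0. H $ i $ i = of_real x \<and> w i s = of_real (x ^ CARD('n))"
  proof eventually_elim
    case (elim s)
    show ?case
    proof (intro ballI allI)
      fix H i assume H: "H \<in> ?F s"
      obtain x where x: "0 < x" "H $ i $ i = of_real x" using invariant_form_diag_pos[OF H] .
      have "of_real (x ^ CARD('n)) = (\<Prod>j\<in>(UNIV::'n set). H $ i $ i)"
        by (simp add: x(2))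
      also have "\<dots> = (\<Prod>j\<in>UNIV. u i j s * H $ j $ j)"
        using elim(2) H by (intro prod.cong) auto
      also have "\<dots> = w i s * det H"
        using elim(1) H by (simp add: is_diagonal_det prod.distrib w_def)
      finally show "\<exists>x>0. H $ i $ i = of_real x \<and> w i s = of_real (x ^ CARD('n))"
        using x invariant_form_det[OF H] by auto
    qed
  qed
  \<comment> \<open>At \<open>t\<close> itself the units are nonzero, so the limit of the positive numbers \<open>w i s\<close> is positive;
    this is what keeps the root analytic and the limiting form definite.\<close>
  have w_pos: "\<exists>y>0. w i t = of_real y" for i
  proof -
    have "\<forall>\<^sub>F s in at t. w i s \<in> \<real>\<^sub>\<ge>\<^sub>0"
      using entries exist
    proof eventually_elim
      case (elim s)
      obtain H where "H \<in> ?F s" using elim(2) by blast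
      then obtain x where "0 < x" "w i s = of_real (x ^ CARD('n))" using elim(1) by blast
      then show ?case by (simp only: nonneg_Reals_of_real_iff) simp
    qed
    moreover have "(w i \<longlongrightarrow> w i t) (at t)"
      using real_analytic_at_imp_continuous[OF w] by (simp add: isCont_def)
    ultimately have "w i t \<in> \<real>\<^sub>\<ge>\<^sub>0"
      using Lim_in_closed_set[OF closed_nonneg_Reals_complex] by (metis trivial_limit_at)
    moreover have "w i t \<noteq> 0" using u(2) by (simp add: w_def)
    ultimately show ?thesis
      by (metis nonneg_Reals_cases of_real_0 order_le_less)
  qed

  define h where "h i s = exp (Ln (w i s) / of_nat CARD('n))" for i s
  define Q where "Q s = diagonal_matrix (\<lambda>i. h i s)" for s
  have h: "real_analytic_at (h i) t" for i
    unfolding h_def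
  proof (rule real_analytic_at_exp_Ln_divide[OF w])
    show "w i t \<notin> \<real>\<^sub>\<le>\<^sub>0" using w_pos[of i] by (auto simp: complex_nonpos_Reals_iff)
  qed
  have Q: "real_analytic_at Q t"
    unfolding real_analytic_at_matrix_iff
  proof (intro allI)
    fix i j show "real_analytic_at (\<lambda>s. Q s $ i $ j) t"
      using h by (cases "i = j") (auto simp: Q_def diagonal_matrix_nth intro: real_analytic_intros)
  qed
  have unique: "\<forall>\<^sub>F s in at t. ?F s \<subseteq> {Q s}"
    using entries H_diag
  proof eventually_elim
    case (elim s)
    have "H = Q s" if H: "H \<in> ?F s" for H
    proof -
      have "H $ i $ i = h i s" for i
      proof -
        obtain x where x: "0 < x" "H $ i $ i = of_real x" "w i s = of_real (x ^ CARD('n))"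
          using elim(1) H by blast
        have "h i s = of_real (exp (ln (x ^ CARD('n)) / real CARD('n)))"
          unfolding h_def x(3) by (rule exp_Ln_divide_of_real) (use x(1) in simp)
        also have "\<dots> = of_real x" using x(1) by (simp add: ln_realpow)
        finally show ?thesis using x(2) by simp
      qed
      then show ?thesis
        using elim(2) H by (auto simp: vec_eq_iff Q_def diagonal_matrix_nth is_diagonal_def)
    qed
    then show ?case by blast
  qed
  have Q_F: "\<forall>\<^sub>F s in at t. Q s \<in> ?F s"
    using unique exist by eventually_elim auto
  \<comment> \<open>Determinant one and invariance under each \<open>N k\<close> are closed conditions and hold for \<open>s \<noteq> t\<close>.\<close>
  moreover have "Q t \<in> ?F t"
  proof -
    obtain y where y: "\<And>i. 0 < y i" "\<And>i. w i t = of_real (y i)"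
      using w_pos by metis
    have Qt: "Q t = diagonal_matrix (\<lambda>i. of_real (exp (ln (y i) / real CARD('n))))"
      unfolding Q_def h_def y(2) using y(1) by (simp add: exp_Ln_divide_of_real)
    have "det (Q t) = 1"
    proof (rule continuous_eq_at_limit)
      show "isCont (\<lambda>s. det (Q s)) t"
        using Q by (intro real_analytic_at_imp_continuous real_analytic_intros)
      show "\<forall>\<^sub>F s in at t. det (Q s) = 1"
        using Q_F by eventually_elim (rule invariant_form_det)
    qed simp
    then have "\<exists>V\<in>SL. Q t = conj_transpose V ** V"
      unfolding Qt by (intro positive_diagonal_is_gram) simp
    moreover have "conj_transpose (N k t) ** Q t ** N k t = Q t" if k: "k \<in> I" for k
    proof (rule continuous_eq_at_limit)
      show "isCont (\<lambda>s. conj_transpose (N k s) ** Q s ** N k s) t"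
        using Q N_analytic[OF k] by (intro real_analytic_at_matrix_continuous real_analytic_intros)
      show "isCont Q t" using Q by (rule real_analytic_at_matrix_continuous)
      show "\<forall>\<^sub>F s in at t. conj_transpose (N k s) ** Q s ** N k s = Q s"
        using Q_F by eventually_elim (use k in \<open>auto simp: invariant_forms_def\<close>)
    qed
    ultimately show ?thesis by (auto simp: invariant_forms_def)
  qed
  ultimately have "\<forall>\<^sub>F s in nhds t. Q s \<in> ?F s"
    by (simp add: eventually_nhds_conv_at)
  with Q unique show ?thesis by blast
qed

text \<open>The general case is reduced to a diagonal \<open>N\<^sub>a\<close> by transporting forms along the diagonalizer \<open>C\<close>.\<close>

lemma ex_analytic_invariant_form:
  fixes N :: "'k \<Rightarrow> real \<Rightarrow> complex ^ 'n ^ 'n"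
  assumes N_analytic: "\<And>k. k \<in> I \<Longrightarrow> real_analytic_at (N k) t"
    and N_SL: "\<forall>\<^sub>F s in nhds t. \<forall>k\<in>I. N k s \<in> SL"
    and C: "real_analytic_at C t" "\<forall>\<^sub>F s in nhds t. C s \<in> SL"
    and ab: "a \<in> I" "b \<in> I"
    and diag: "\<forall>\<^sub>F s in nhds t. is_diagonal (conjugate_by (C s) (N a s))"
    and distinct: "\<And>i j. i \<noteq> j \<Longrightarrow> \<not> (\<forall>\<^sub>F s in nhds t.
      conjugate_by (C s) (N a s) $ i $ i = conjugate_by (C s) (N a s) $ j $ j)"
    and G: "connected_graph G"
    and compat: "\<And>i j. (i, j) \<in> G \<Longrightarrow>
      vanishing_order (\<lambda>s. conjugate_by (C s) (N b s) $ i $ j) t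
        = vanishing_order (\<lambda>s. matrix_inv (conj_transpose (conjugate_by (C s) (N b s))) $ i $ j) t \<and>
      vanishing_order (\<lambda>s. conjugate_by (C s) (N b s) $ i $ j) t < \<infinity>"
    and exist: "\<forall>\<^sub>F s in at t. invariant_forms ((\<lambda>k. N k s) ` I) \<noteq> {}"
  shows "\<exists>Q. real_analytic_at Q t \<and>
    (\<forall>\<^sub>F s in nhds t. Q s \<in> invariant_forms ((\<lambda>k. N k s) ` I)) \<and>
    (\<forall>\<^sub>F s in at t. invariant_forms ((\<lambda>k. N k s) ` I) \<subseteq> {Q s})"
proof -
  define N' where "N' k s = conjugate_by (C s) (N k s)" for k s
  let ?F = "\<lambda>s. invariant_forms ((\<lambda>k. N k s) ` I)" and ?F' = "\<lambda>s. invariant_forms ((\<lambda>k. N' k s) ` I)"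
  have img: "(\<lambda>k. N' k s) ` I = conjugate_by (C s) ` ((\<lambda>k. N k s) ` I)" for s
    by (simp add: N'_def image_image)
  note at = eventually_nhds_imp_at
  have to: "conj_transpose (matrix_inv (C s)) ** H ** matrix_inv (C s) \<in> ?F' s"
    if "C s \<in> SL" "H \<in> ?F s" for s H
    unfolding img using that by (rule invariant_forms_to_conjugates)
  have "real_analytic_at (N' k) t" if "k \<in> I" for k
    unfolding N'_def conjugate_by_def using N_analytic[OF that] C by (intro real_analytic_intros)
  moreover have "\<forall>\<^sub>F s in nhds t. \<forall>k\<in>I. N' k s \<in> SL"
    using N_SL C(2) by eventually_elim (auto simp: N'_def SL_conjugate_by)
  moreover have "\<forall>\<^sub>F s in at t. ?F' s \<noteq> {}"
    using exist at[OF C(2)] by eventually_elim (use to in blast)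
  ultimately obtain Q' where Q': "real_analytic_at Q' t" "\<forall>\<^sub>F s in nhds t. Q' s \<in> ?F' s"
      "\<forall>\<^sub>F s in at t. ?F' s \<subseteq> {Q' s}"
    using ex_analytic_invariant_form_diagonal[of I N' t a b G,
        OF _ _ ab diag[folded N'_def] distinct[folded N'_def] G
        compat[folded N'_def]]
    by auto
  define Q where "Q s = conj_transpose (C s) ** Q' s ** C s" for s
  have "real_analytic_at Q t"
    unfolding Q_def using Q'(1) C by (intro real_analytic_intros)
  moreover have "\<forall>\<^sub>F s in nhds t. Q s \<in> ?F s"
    using Q'(2) C(2)
    by eventually_elim (unfold Q_def img, rule invariant_forms_from_conjugates)
  moreover have "\<forall>\<^sub>F s in at t. ?F s \<subseteq> {Q s}"
    using Q'(3) at[OF C(2)]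
  proof eventually_elim
    case (elim s)
    have "H = Q s" if "H \<in> ?F s" for H
    proof -
      have "Q s = conj_transpose (C s) ** (conj_transpose (matrix_inv (C s)) ** H ** matrix_inv (C s)) ** C s"
        using to[OF elim(2) that] elim(1) by (auto simp: Q_def)
      also have "\<dots> = conj_transpose (matrix_inv (C s) ** C s) ** (H ** (matrix_inv (C s) ** C s))"
        by (simp add: conj_transpose_mult matrix_mul_assoc)
      finally show ?thesis by (simp add: SL_inverse[OF elim(2)])
    qed
    then show ?case by blast
  qed
  ultimately show ?thesis by blast
qed

text \<open>Necessity of compatibility: by continuity the form is diagonal at \<open>t\<close> too, so its diagonal entries
give an analytic unit \<open>h\<^sub>i / h\<^sub>j\<close> by which \<open>P\<^sub>i\<^sub>j\<close> and the corresponding entry of \<open>(P\<^sup>*)\<inverse>\<close> differ.\<close>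

lemma invariant_form_imp_equal_orders:
  fixes D P H :: "real \<Rightarrow> complex ^ 'n ^ 'n"
  assumes D: "real_analytic_at D t" and P: "real_analytic_at P t" and H: "real_analytic_at H t"
    and P_SL: "\<forall>\<^sub>F s in nhds t. P s \<in> SL"
    and diag: "\<forall>\<^sub>F s in nhds t. is_diagonal (D s)"
    and distinct: "\<And>i j. i \<noteq> j \<Longrightarrow> \<not> (\<forall>\<^sub>F s in nhds t. D s $ i $ i = D s $ j $ j)"
    and form: "\<forall>\<^sub>F s in nhds t. H s \<in> invariant_forms {D s, P s}"
    and nz: "\<not> (\<forall>\<^sub>F s in nhds t. P s $ i $ j = 0)"
  shows "vanishing_order (\<lambda>s. P s $ i $ j) t
           = vanishing_order (\<lambda>s. matrix_inv (conj_transpose (P s)) $ i $ j) t"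
    "vanishing_order (\<lambda>s. P s $ i $ j) t < \<infinity>"
proof -
  have H_diag: "\<forall>\<^sub>F s in at t. is_diagonal (H s)"
  proof -
    have "\<forall>\<^sub>F s in at t. \<forall>\<N>. D s \<in> \<N> \<longrightarrow> (\<forall>H\<in>invariant_forms \<N>. is_diagonal H)"
      by (rule eventually_invariant_forms_diagonal[OF D diag distinct])
    with eventually_nhds_imp_at[OF form] show ?thesis
      by eventually_elim auto
  qed
  have Ht: "H t $ k $ l = 0" if "k \<noteq> l" for k l
  proof (rule continuous_eq_at_limit)
    show "isCont (\<lambda>s. H s $ k $ l) t"
      using H by (intro real_analytic_at_imp_continuous real_analytic_at_component)
    show "\<forall>\<^sub>F s in at t. H s $ k $ l = 0"
      using H_diag by eventually_elim (use that in \<open>auto simp: is_diagonal_def\<close>)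
  qed simp
  then have "is_diagonal (H t)" by (simp add: is_diagonal_def)
  with H_diag have H_diag': "\<forall>\<^sub>F s in nhds t. is_diagonal (H s)"
    by (simp add: eventually_nhds_conv_at)
  have H_nz: "H s $ k $ k \<noteq> 0" if "H s \<in> invariant_forms {D s, P s}" for s k
    using invariant_form_diag_pos[OF that, of k] by fastforce
  let ?u = "\<lambda>s. H s $ i $ i / H s $ j $ j"
  have Pij: "real_analytic_at (\<lambda>s. P s $ i $ j) t"
    using P by (rule real_analytic_at_component)
  have u: "real_analytic_at ?u t" "?u t \<noteq> 0"
    using H H_nz[OF eventually_nhds_x_imp_x[OF form]]
    by (auto intro!: real_analytic_intros real_analytic_at_component)
  have R: "\<forall>\<^sub>F s in nhds t. matrix_inv (conj_transpose (P s)) $ i $ j = ?u s * P s $ i $ j"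
    using form H_diag' P_SL
  proof eventually_elim
    case (elim s)
    have "H s $ i $ i * P s $ i $ j = matrix_inv (conj_transpose (P s)) $ i $ j * H s $ j $ j"
      by (rule diagonal_invariant_form_ratio[OF elim(1)]) (use elim in auto)
    then show ?case using H_nz[OF elim(1)] by (simp add: field_simps)
  qed
  show "vanishing_order (\<lambda>s. P s $ i $ j) t
      = vanishing_order (\<lambda>s. matrix_inv (conj_transpose (P s)) $ i $ j) t"
    "vanishing_order (\<lambda>s. P s $ i $ j) t < \<infinity>"
    using vanishing_order_mult_unit[OF Pij u R nz] by auto
qed

section \<open>Analytic Gram-Schmidt orthonormalization\<close>

definition hermitian_form :: "complex ^ 'n ^ 'n \<Rightarrow> complex ^ 'n \<Rightarrow> complex ^ 'n \<Rightarrow> complex" where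
  "hermitian_form H u v = (\<Sum>k\<in>UNIV. cnj (u $ k) * (H *v v) $ k)"

lemma real_analytic_at_matrix_vector_mult [real_analytic_intros]:
  fixes A :: "real \<Rightarrow> complex ^ 'n ^ 'm" and v :: "real \<Rightarrow> complex ^ 'n"
  shows "real_analytic_at A t \<Longrightarrow> real_analytic_at v t \<Longrightarrow> real_analytic_at (\<lambda>s. A s *v v s) t"
  by (auto simp: real_analytic_at_vec_iff matrix_vector_mult_def intro!: real_analytic_intros)

lemma real_analytic_at_hermitian_form [real_analytic_intros]:
  fixes H :: "real \<Rightarrow> complex ^ 'n ^ 'n"
  assumes "real_analytic_at H t" "real_analytic_at u t" "real_analytic_at v t"
  shows "real_analytic_at (\<lambda>s. hermitian_form (H s) (u s) (v s)) t"
proof -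
  have "real_analytic_at (\<lambda>s. u s $ k) t" "real_analytic_at (\<lambda>s. (H s *v v s) $ k) t" for k
    using assms(2) real_analytic_at_matrix_vector_mult[OF assms(1,3)]
    by (simp_all add: real_analytic_at_vec_iff)
  then show ?thesis unfolding hermitian_form_def by (intro real_analytic_intros)
qed

lemma hermitian_form_diff: "hermitian_form H u (v - w) = hermitian_form H u v - hermitian_form H u w"
  by (simp add: hermitian_form_def matrix_vector_mult_diff_distrib right_diff_distrib sum_subtractf)

lemma hermitian_form_scale:
  "hermitian_form H u (c *s v) = c * hermitian_form H u v"
  "hermitian_form H (c *s u) v = cnj c * hermitian_form H u v"
  by (simp_all add: hermitian_form_def vec.scale sum_distrib_left mult_ac)

lemma hermitian_form_sum: "hermitian_form H u (\<Sum>j\<in>S. f j) = (\<Sum>j\<in>S. hermitian_form H u (f j))"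
proof -
  have "hermitian_form H u 0 = 0" by (simp add: hermitian_form_def)
  moreover have "hermitian_form H u (v + w) = hermitian_form H u v + hermitian_form H u w" for v w
    by (simp add: hermitian_form_def matrix_vector_right_distrib distrib_left sum.distrib)
  ultimately show ?thesis
    by (induction S rule: infinite_finite_induct) auto
qed

lemma sum_cnj_matrix_vector_mult:
  "(\<Sum>k\<in>UNIV. cnj (u $ k) * (conj_transpose V *v v) $ k) = (\<Sum>k\<in>UNIV. cnj ((V *v u) $ k) * v $ k)"
proof -
  have "(\<Sum>k\<in>UNIV. cnj (u $ k) * (conj_transpose V *v v) $ k) =
      (\<Sum>k\<in>UNIV. \<Sum>l\<in>UNIV. cnj (u $ k) * (cnj (V $ l $ k) * v $ l))"
    by (simp add: matrix_vector_mult_def sum_distrib_left)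
  also have "\<dots> = (\<Sum>l\<in>UNIV. \<Sum>k\<in>UNIV. cnj (u $ k) * (cnj (V $ l $ k) * v $ l))"
    by (rule sum.swap)
  also have "\<dots> = (\<Sum>k\<in>UNIV. cnj ((V *v u) $ k) * v $ k)"
    by (simp add: matrix_vector_mult_def sum_distrib_left sum_distrib_right mult_ac)
  finally show ?thesis .
qed

lemma hermitian_form_gram:
  "hermitian_form (conj_transpose V ** V) u v = (\<Sum>k\<in>UNIV. cnj ((V *v u) $ k) * (V *v v) $ k)"
  unfolding hermitian_form_def by (simp add: sum_cnj_matrix_vector_mult flip: matrix_vector_mul_assoc)

lemma hermitian_form_hermitian:
  assumes "H \<in> invariant_forms \<N>"
  shows "hermitian_form H v u = cnj (hermitian_form H u v)"
  using assms by (auto simp: invariant_forms_def hermitian_form_gram mult.commute)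

lemma hermitian_form_pos:
  assumes H: "H \<in> invariant_forms \<N>" and u: "u \<noteq> 0"
  obtains x where "0 < x" "hermitian_form H u u = of_real x"
proof -
  obtain V where V: "V \<in> SL" "H = conj_transpose V ** V"
    using H by (auto simp: invariant_forms_def)
  have "V *v u \<noteq> 0"
  proof
    assume "V *v u = 0"
    then have "matrix_inv V *v (V *v u) = 0" by simp
    then show False using u by (simp add: matrix_vector_mul_assoc SL_inverse[OF V(1)])
  qed
  then obtain k where "(V *v u) $ k \<noteq> 0" by (auto simp: vec_eq_iff)
  then have "0 < (\<Sum>k\<in>UNIV. (cmod ((V *v u) $ k))\<^sup>2)"
    by (intro sum_pos2[of _ k]) auto
  moreover have "hermitian_form H u u = of_real (\<Sum>k\<in>UNIV. (cmod ((V *v u) $ k))\<^sup>2)"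
    unfolding V(2) hermitian_form_gram of_real_sum by (simp add: mult.commute flip: complex_norm_square)
  ultimately show thesis using that by blast
qed

text \<open>A family \<open>w\<close> that depends on the form alone and is \<open>H\<close>-orthonormal for each \<open>H\<close>. Analytic dependence
is expressed along arbitrary analytic paths \<open>Q\<close> of forms. The support condition is what lets the
induction add an index: the standard basis vector of a new index stays outside the span of the
family.\<close>

definition analytic_orthonormalization ::
    "'n::finite set \<Rightarrow> ('n \<Rightarrow> complex ^ 'n ^ 'n \<Rightarrow> complex ^ 'n) \<Rightarrow> bool" where
  "analytic_orthonormalization S w \<longleftrightarrow>
     (\<forall>H\<in>invariant_forms {}.
        (\<forall>i\<in>S. \<forall>j\<in>S. hermitian_form H (w i H) (w j H) = (if i = j then 1 else 0)) \<and>
        (\<forall>i\<in>S. \<forall>k. k \<notin> S \<longrightarrow> w i H $ k = 0)) \<and>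
     (\<forall>Q t. real_analytic_at Q t \<longrightarrow> (\<forall>\<^sub>F s in nhds t. Q s \<in> invariant_forms {}) \<longrightarrow>
        (\<forall>i\<in>S. real_analytic_at (\<lambda>s. w i (Q s)) t))"

text \<open>A new index \<open>k\<close> is added by projecting the basis vector \<open>axis k 1\<close> off the family and normalizing. The
projection \<open>u\<close> has \<open>k\<close>-th coordinate 1, so its norm is positive and the square root is analytic.\<close>

lemma gram_schmidt:
  fixes S :: "'n::finite set"
  shows "\<exists>w. analytic_orthonormalization S w"
  using finite[of S]
proof (induction S rule: finite_induct)
  case empty
  show ?case by (simp add: analytic_orthonormalization_def)
next
  case (insert k S)
  then obtain w where w: "analytic_orthonormalization S w" by blast
  have ortho: "hermitian_form H (w i H) (w j H) = (if i = j then 1 else 0)"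
    if "H \<in> invariant_forms {}" "i \<in> S" "j \<in> S" for H i j
    using w that unfolding analytic_orthonormalization_def by blast
  have support: "w i H $ l = 0" if "H \<in> invariant_forms {}" "i \<in> S" "l \<notin> S" for H i l
    using w that unfolding analytic_orthonormalization_def by blast
  define u where "u H = axis k 1 - (\<Sum>j\<in>S. hermitian_form H (w j H) (axis k 1) *s w j H)" for H
  define v where "v H = (1 / exp (Ln (hermitian_form H (u H) (u H)) / of_nat 2)) *s u H" for H
  let ?w = "w(k := v)"
  have u_k: "u H $ k = 1" if "H \<in> invariant_forms {}" for H
    using support[OF that] insert(2) by (simp add: u_def axis_def)
  then have u_nz: "u H \<noteq> 0" if "H \<in> invariant_forms {}" for H
    using that by force
  have u_ortho: "hermitian_form H (w i H) (u H) = 0" if H: "H \<in> invariant_forms {}" and i: "i \<in> S" for H i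
  proof -
    have "(\<Sum>j\<in>S. hermitian_form H (w j H) (axis k 1) * hermitian_form H (w i H) (w j H)) =
        (\<Sum>j\<in>S. if i = j then hermitian_form H (w j H) (axis k 1) else 0)"
      by (rule sum.cong) (use ortho[OF H i] in auto)
    then show ?thesis
      using i insert(1) by (simp add: u_def hermitian_form_diff hermitian_form_sum hermitian_form_scale)
  qed
  have v_ortho: "hermitian_form H (w i H) (v H) = 0" "hermitian_form H (v H) (w i H) = 0"
    if H: "H \<in> invariant_forms {}" and i: "i \<in> S" for H i
  proof -
    show "hermitian_form H (w i H) (v H) = 0"
      by (simp add: v_def hermitian_form_scale u_ortho[OF H i])
    then show "hermitian_form H (v H) (w i H) = 0"
      using hermitian_form_hermitian[OF H, of "v H" "w i H"] by simp
  qed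
  have v_norm: "hermitian_form H (v H) (v H) = 1" if H: "H \<in> invariant_forms {}" for H
  proof -
    obtain x where x: "0 < x" "hermitian_form H (u H) (u H) = of_real x"
      using hermitian_form_pos[OF H u_nz[OF H]] .
    let ?e = "exp (ln x / real 2)"
    have e: "exp (Ln (hermitian_form H (u H) (u H)) / of_nat 2) = of_real ?e"
      unfolding x(2) using x(1) by (rule exp_Ln_divide_of_real)
    have "?e * ?e = x"
      using x(1) by (simp flip: exp_add)
    then have "of_real ?e * of_real ?e = complex_of_real x"
      by (simp only: flip: of_real_mult)
    then show ?thesis
      unfolding v_def e using x by (simp add: hermitian_form_scale)
  qed
  have analytic_v: "real_analytic_at (\<lambda>s. v (Q s)) t"
    if Q: "real_analytic_at Q t" and form: "\<forall>\<^sub>F s in nhds t. Q s \<in> invariant_forms {}" for Q t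
  proof -
    have wQ: "real_analytic_at (\<lambda>s. w i (Q s)) t" if "i \<in> S" for i
      using w Q form that unfolding analytic_orthonormalization_def by blast
    then have wQ': "real_analytic_at (\<lambda>s. w i (Q s) $ l) t" if "i \<in> S" for i l
      using that by (simp add: real_analytic_at_vec_iff)
    have const: "real_analytic_at (\<lambda>s. c) t" for c :: "complex ^ 'n"
      by (simp add: real_analytic_at_vec_iff real_analytic_at_const)
    have "real_analytic_at (\<lambda>s. u (Q s) $ l) t" for l
      unfolding u_def using Q wQ wQ'
      by (auto intro!: real_analytic_intros const)
    then have uQ: "real_analytic_at (\<lambda>s. u (Q s)) t"
      by (simp add: real_analytic_at_vec_iff)
    have form_t: "Q t \<in> invariant_forms {}"
      using form by (rule eventually_nhds_x_imp_x)
    obtain x where x: "0 < x" "hermitian_form (Q t) (u (Q t)) (u (Q t)) = of_real x"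
      using hermitian_form_pos[OF form_t u_nz[OF form_t]] .
    have "real_analytic_at (\<lambda>s. exp (Ln (hermitian_form (Q s) (u (Q s)) (u (Q s))) / of_nat 2)) t"
      by (rule real_analytic_at_exp_Ln_divide)
        (use x in \<open>auto intro!: real_analytic_intros Q uQ simp: complex_nonpos_Reals_iff\<close>)
    then have "real_analytic_at (\<lambda>s. v (Q s) $ l) t" for l
      unfolding v_def using uQ
      by (auto intro!: real_analytic_intros simp: real_analytic_at_vec_iff)
    then show ?thesis by (simp add: real_analytic_at_vec_iff)
  qed
  have "v H $ l = 0" if "H \<in> invariant_forms {}" "l \<notin> insert k S" for H l
    using that support[OF that(1)] by (simp add: v_def u_def axis_def)
  then have "analytic_orthonormalization (insert k S) ?w"
    using insert(2) w ortho support v_ortho v_norm analytic_v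
    unfolding analytic_orthonormalization_def by auto
  then show ?case by blast
qed

text \<open>If the columns of \<open>B\<close> are \<open>H\<close>-orthonormal, that is \<open>B\<^sup>* H B = 1\<close>, then \<open>\<Phi> = B\<^sup>* H\<close> is the inverse of
\<open>B\<close> and satisfies \<open>\<Phi>\<^sup>* \<Phi> = H B B\<^sup>* H = H\<close>.\<close>

lemma analytic_gram_factor:
  obtains \<Phi> :: "complex ^ 'n ^ 'n \<Rightarrow> complex ^ 'n ^ 'n" where
    "\<And>H. H \<in> invariant_forms {} \<Longrightarrow> \<Phi> H \<in> SL"
    "\<And>H. H \<in> invariant_forms {} \<Longrightarrow> conj_transpose (\<Phi> H) ** \<Phi> H = H"
    "\<And>Q t. real_analytic_at Q t \<Longrightarrow> \<forall>\<^sub>F s in nhds t. Q s \<in> invariant_forms {} \<Longrightarrow>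
       real_analytic_at (\<lambda>s. \<Phi> (Q s)) t"
proof -
  obtain w :: "'n \<Rightarrow> complex ^ 'n ^ 'n \<Rightarrow> complex ^ 'n"
    where w: "analytic_orthonormalization UNIV w"
    using gram_schmidt by blast
  have ortho: "hermitian_form H (w i H) (w j H) = (if i = j then 1 else 0)"
    if "H \<in> invariant_forms {}" for H i j
    using w that unfolding analytic_orthonormalization_def by blast
  have analytic: "real_analytic_at (\<lambda>s. w i (Q s)) t"
    if "real_analytic_at Q t" "\<forall>\<^sub>F s in nhds t. Q s \<in> invariant_forms {}" for Q t i
    using w that unfolding analytic_orthonormalization_def by blast
  obtain i0 :: 'n where True by blast
  define W where "W H = (\<chi> a i. w i H $ a)" for H
  \<comment> \<open>The determinant of \<open>W\<close> is unimodular because \<open>det H = 1\<close>; \<open>E\<close> is a diagonal unitary matrix that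
    scales one column to make the determinant 1.\<close>
  define E where "E H = diagonal_matrix (\<lambda>i. if i = i0 then cnj (det (W H)) else 1)" for H
  define B where "B H = W H ** E H" for H
  have W: "conj_transpose (W H) ** (H ** W H) = mat 1" if H: "H \<in> invariant_forms {}" for H
  proof -
    have "(conj_transpose (W H) ** (H ** W H)) $ i $ j = hermitian_form H (w i H) (w j H)" for i j
      by (simp add: hermitian_form_def W_def matrix_matrix_mult_def matrix_vector_mult_def)
    then show ?thesis by (simp add: vec_eq_iff ortho[OF H] mat_def)
  qed
  have det_W: "det (W H) * cnj (det (W H)) = 1" if H: "H \<in> invariant_forms {}" for H
  proof -
    have "det (conj_transpose (W H) ** (H ** W H)) = 1" by (simp add: W[OF H])
    then show ?thesis
      by (simp add: det_mul det_conj_transpose invariant_form_det[OF H] mult.commute)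
  qed
  have det_E: "det (E H) = cnj (det (W H))" for H
  proof -
    have "det (E H) = (\<Prod>i\<in>UNIV. if i = i0 then cnj (det (W H)) else 1)"
      by (simp add: E_def is_diagonal_det[OF is_diagonal_diagonal_matrix] diagonal_matrix_nth)
    also have "\<dots> = cnj (det (W H))" by (simp add: prod.delta)
    finally show ?thesis .
  qed
  have E: "conj_transpose (E H) ** E H = mat 1" if H: "H \<in> invariant_forms {}" for H
    using det_W[OF H] unfolding E_def
    by (auto simp: vec_eq_iff mat_def diagonal_mult_nth(2)[OF is_diagonal_diagonal_matrix] diagonal_matrix_nth)
  have B_SL: "B H \<in> SL" if "H \<in> invariant_forms {}" for H
    using det_W[OF that] by (simp add: SL_def B_def det_mul det_E)
  have B: "conj_transpose (B H) ** H ** B H = mat 1" if H: "H \<in> invariant_forms {}" for H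
  proof -
    have "conj_transpose (B H) ** H ** B H =
        conj_transpose (E H) ** ((conj_transpose (W H) ** (H ** W H)) ** E H)"
      by (simp add: B_def conj_transpose_mult matrix_mul_assoc)
    also have "\<dots> = mat 1" by (simp add: W[OF H] E[OF H])
    finally show ?thesis .
  qed
  show thesis
  proof (rule that[of "\<lambda>H. conj_transpose (B H) ** H"])
    fix H :: "complex ^ 'n ^ 'n" assume H: "H \<in> invariant_forms {}"
    have H_SL: "H \<in> SL" using invariant_form_det[OF H] by (simp add: SL_def)
    show "conj_transpose (B H) ** H \<in> SL"
      using B_SL[OF H] H_SL by (intro SL_mult SL_conj_transpose)
    have herm: "conj_transpose H = H"
    proof -
      obtain V where "V \<in> SL" "H = conj_transpose V ** V"
        using H by (auto simp: invariant_forms_def)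
      moreover have "conj_transpose (conj_transpose V) = V" by (simp add: vec_eq_iff)
      ultimately show ?thesis by (simp add: conj_transpose_mult)
    qed
    have "B H ** (conj_transpose (B H) ** H) = mat 1"
      using B[OF H] matrix_left_right_inverse by blast
    then have "H ** (B H ** (conj_transpose (B H) ** H)) = H" by simp
    moreover have "conj_transpose (conj_transpose (B H)) = B H" by (simp add: vec_eq_iff)
    ultimately show "conj_transpose (conj_transpose (B H) ** H) ** (conj_transpose (B H) ** H) = H"
      by (simp add: conj_transpose_mult herm matrix_mul_assoc)
  next
    fix Q :: "real \<Rightarrow> complex ^ 'n ^ 'n" and t
    assume Q: "real_analytic_at Q t" and form: "\<forall>\<^sub>F s in nhds t. Q s \<in> invariant_forms {}"
    have "real_analytic_at (\<lambda>s. W (Q s)) t"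
      using analytic[OF Q form] by (simp add: W_def real_analytic_at_matrix_iff real_analytic_at_vec_iff)
    moreover from this have "real_analytic_at (\<lambda>s. E (Q s) $ i $ j) t" for i j
      unfolding E_def diagonal_matrix_nth
      by (cases "i = j"; cases "i = i0") (auto intro!: real_analytic_intros)
    ultimately show "real_analytic_at (\<lambda>s. conj_transpose (B (Q s)) ** Q s) t"
      unfolding B_def using Q by (intro real_analytic_intros) (auto simp: real_analytic_at_matrix_iff)
  qed
qed

section \<open>Neighbourhoods in charts\<close>

lemma analytic_curve_chart:
  assumes "analytic_curve X \<A>" "(U, \<phi>) \<in> \<A>"
  shows "openin X U" "open (\<phi> ` U)" "homeomorphic_map (subtopology X U) (top_of_set (\<phi> ` U)) \<phi>"
    "inj_on \<phi> U"
proof -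
  show U: "openin X U" "open (\<phi> ` U)"
    and hom: "homeomorphic_map (subtopology X U) (top_of_set (\<phi> ` U)) \<phi>"
    using assms unfolding analytic_curve_def by auto
  have "topspace (subtopology X U) = U"
    using openin_subset[OF U(1)] by auto
  with hom show "inj_on \<phi> U" by (metis homeomorphic_imp_injective_map)
qed

text \<open>Charts are homeomorphisms, so statements holding near a point of the curve translate into
statements about a real variable.\<close>

lemma nhdsin_eq_filtermap_chart:
  assumes curve: "analytic_curve X \<A>" and chart: "(U, \<phi>) \<in> \<A>" and p: "p \<in> U"
  shows "nhdsin X p = filtermap (inv_into U \<phi>) (nhds (\<phi> p))"
proof (rule filter_eqI, unfold eventually_filtermap)
  note U = analytic_curve_chart[OF curve chart]
  have top: "topspace (subtopology X U) = U"
    using openin_subset[OF U(1)] by auto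
  have pX: "p \<in> topspace X" using openin_subset[OF U(1)] p by auto
  fix Q
  show "eventually Q (nhdsin X p) \<longleftrightarrow> (\<forall>\<^sub>F s in nhds (\<phi> p). Q (inv_into U \<phi> s))"
  proof
    assume "eventually Q (nhdsin X p)"
    then obtain S where S: "openin X S" "p \<in> S" "\<And>x. x \<in> S \<Longrightarrow> Q x"
      using pX by (auto simp: eventually_nhdsin)
    have "openin (subtopology X U) (S \<inter> U)"
      using S(1) by (auto simp: openin_subtopology)
    then have "openin (top_of_set (\<phi> ` U)) (\<phi> ` (S \<inter> U))"
      using homeomorphic_imp_open_map[OF U(3)] by (auto simp: open_map_def)
    then have "open (\<phi> ` (S \<inter> U))"
      using U(2) by (simp add: openin_open_eq)
    moreover have "\<phi> p \<in> \<phi> ` (S \<inter> U)" using S(2) p by blast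
    moreover have "Q (inv_into U \<phi> s)" if "s \<in> \<phi> ` (S \<inter> U)" for s
      using that S(3) U(4) by auto
    ultimately show "\<forall>\<^sub>F s in nhds (\<phi> p). Q (inv_into U \<phi> s)"
      unfolding eventually_nhds by blast
  next
    assume "\<forall>\<^sub>F s in nhds (\<phi> p). Q (inv_into U \<phi> s)"
    then obtain T where T: "open T" "\<phi> p \<in> T" "\<And>s. s \<in> T \<Longrightarrow> Q (inv_into U \<phi> s)"
      unfolding eventually_nhds by blast
    have "openin (top_of_set (\<phi> ` U)) (T \<inter> \<phi> ` U)"
      using T(1) by (auto simp: openin_open)
    then have "openin (subtopology X U) {x \<in> topspace (subtopology X U). \<phi> x \<in> T \<inter> \<phi> ` U}"
      using homeomorphic_imp_continuous_map[OF U(3)] openin_continuous_map_preimage by blast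
    moreover have "{x \<in> topspace (subtopology X U). \<phi> x \<in> T \<inter> \<phi> ` U} = {x \<in> U. \<phi> x \<in> T}"
      unfolding top by auto
    ultimately have "openin (subtopology X U) {x \<in> U. \<phi> x \<in> T}"
      by (simp only:)
    then have "openin X {x \<in> U. \<phi> x \<in> T}"
      using U(1) by (simp add: openin_open_subtopology)
    moreover have "Q x" if "x \<in> {x \<in> U. \<phi> x \<in> T}" for x
      using that T(3)[of "\<phi> x"] U(4) by simp
    ultimately show "eventually Q (nhdsin X p)"
      using p T(2) unfolding eventually_nhdsin by blast
  qed
qed

lemma atin_eq_filtermap_chart:
  assumes curve: "analytic_curve X \<A>" and chart: "(U, \<phi>) \<in> \<A>" and p: "p \<in> U"
  shows "atin X p = filtermap (inv_into U \<phi>) (at (\<phi> p))"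
proof (rule filter_eqI, unfold eventually_filtermap)
  note U = analytic_curve_chart[OF curve chart]
  have pX: "p \<in> topspace X" using openin_subset[OF U(1)] p by auto
  fix Q
  have "eventually Q (atin X p) \<longleftrightarrow> (\<forall>\<^sub>F x in nhdsin X p. x \<noteq> p \<longrightarrow> Q x)"
    using pX by (auto simp: eventually_atin eventually_nhdsin)
  also have "\<dots> \<longleftrightarrow> (\<forall>\<^sub>F s in nhds (\<phi> p). inv_into U \<phi> s \<noteq> p \<longrightarrow> Q (inv_into U \<phi> s))"
    by (simp add: nhdsin_eq_filtermap_chart[OF assms] eventually_filtermap)
  also have "\<dots> \<longleftrightarrow> (\<forall>\<^sub>F s in nhds (\<phi> p). s \<noteq> \<phi> p \<longrightarrow> Q (inv_into U \<phi> s))"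
  proof (rule eventually_cong)
    show "\<forall>\<^sub>F s in nhds (\<phi> p). s \<in> \<phi> ` U"
      using U(2) p by (intro eventually_nhds_in_open) auto
    fix s assume "s \<in> \<phi> ` U"
    then show "(inv_into U \<phi> s \<noteq> p \<longrightarrow> Q (inv_into U \<phi> s)) \<longleftrightarrow> (s \<noteq> \<phi> p \<longrightarrow> Q (inv_into U \<phi> s))"
      using U(4) p by auto
  qed
  also have "\<dots> \<longleftrightarrow> (\<forall>\<^sub>F s in at (\<phi> p). Q (inv_into U \<phi> s))"
    by (simp add: eventually_at_filter)
  finally show "eventually Q (atin X p) \<longleftrightarrow> (\<forall>\<^sub>F s in at (\<phi> p). Q (inv_into U \<phi> s))" .
qed

section \<open>Unitarizers on a curve\<close>

locale diagonalizable_maps =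
  fixes X :: "'a topology" and \<A> :: "('a set \<times> ('a \<Rightarrow> real)) set" and q :: nat
    and M :: "nat \<Rightarrow> 'a \<Rightarrow> complex ^ 'n ^ 'n"
  assumes curve: "analytic_curve X \<A>"
    and q: "q \<ge> 2"
    and M_analytic: "\<And>k. k \<in> {1..q} \<Longrightarrow> curve_analytic_on \<A> (topspace X) (M k)"
    and M_SL: "\<And>k. k \<in> {1..q} \<Longrightarrow> M k ` topspace X \<subseteq> SL"
    and diagonalizable: "\<And>p. p \<in> topspace X \<Longrightarrow> locally_diagonalizable_at X \<A> (M 1) p"
    and distinct: "\<And>p. p \<in> topspace X \<Longrightarrow> local_eigenvalues_distinct X \<A> (M 1) p"
begin

abbreviation forms :: "'a \<Rightarrow> (complex ^ 'n ^ 'n) set" where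
  "forms x \<equiv> invariant_forms ((\<lambda>k. M k x) ` {1..q})"

definition compatible_at :: "'a \<Rightarrow> bool" where
  "compatible_at p \<longleftrightarrow> (\<forall>U C. local_diagonalizer X \<A> (M 1) p U C \<longrightarrow>
     (\<exists>G. connected_graph G \<and>
        G_compatible_at \<A> G p
          (\<lambda>x. conjugate_by (C x) (M 2 x))
          (\<lambda>x. matrix_inv (conj_transpose (conjugate_by (C x) (M 2 x))))))"

lemma M_in_SL: "k \<in> {1..q} \<Longrightarrow> x \<in> topspace X \<Longrightarrow> M k x \<in> SL"
  using M_SL by blast

lemma unitarizes_iff_form:
  assumes "V \<in> SL" "x \<in> topspace X"
  shows "(\<forall>k\<in>{1..q}. conjugate_by V (M k x) \<in> SU) \<longleftrightarrow> conj_transpose V ** V \<in> forms x"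
  using assms conjugate_by_in_SU_iff[OF assms(1) M_in_SL[OF _ assms(2)]]
  by (auto simp: invariant_forms_def)

lemma pointwise_unitarizable_iff:
  assumes "x \<in> topspace X"
  shows "pointwise_unitarizable_at q M x \<longleftrightarrow> forms x \<noteq> {}"
proof -
  have "pointwise_unitarizable_at q M x \<longleftrightarrow> (\<exists>V\<in>SL. conj_transpose V ** V \<in> forms x)"
    unfolding pointwise_unitarizable_at_def using unitarizes_iff_form[OF _ assms] by blast
  also have "\<dots> \<longleftrightarrow> forms x \<noteq> {}"
    by (auto simp: invariant_forms_def)
  finally show ?thesis .
qed

lemma ex_chart:
  assumes "p \<in> topspace X"
  obtains U \<phi> where "(U, \<phi>) \<in> \<A>" "p \<in> U"
  using assms curve unfolding analytic_curve_def by blast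

context
  fixes p U \<phi>
  assumes p: "p \<in> topspace X" and chart: "(U, \<phi>) \<in> \<A>" and pU: "p \<in> U"
begin

lemma inv_chart: "inv_into U \<phi> (\<phi> p) = p"
  using analytic_curve_chart(4)[OF curve chart] pU by simp

lemma eventually_chart:
  "(\<forall>\<^sub>F s in nhds (\<phi> p). P (inv_into U \<phi> s)) \<longleftrightarrow> (\<forall>\<^sub>F x in nhdsin X p. P x)"
  by (simp add: nhdsin_eq_filtermap_chart[OF curve chart pU] eventually_filtermap)

lemma eventually_chart_openin:
  assumes "openin X W" "p \<in> W"
  shows "\<forall>\<^sub>F s in nhds (\<phi> p). inv_into U \<phi> s \<in> W"
  using assms eventually_chart[of "\<lambda>x. x \<in> W"] by (auto simp: eventually_nhdsin)

lemma eventually_chart_topspace: "\<forall>\<^sub>F s in nhds (\<phi> p). inv_into U \<phi> s \<in> topspace X"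
  using p by (intro eventually_chart_openin) auto

lemma curve_analytic_in_chart:
  "curve_analytic_on \<A> W f \<Longrightarrow> p \<in> W \<Longrightarrow> real_analytic_at (\<lambda>s. f (inv_into U \<phi> s)) (\<phi> p)"
  using chart pU unfolding curve_analytic_on_def by (fastforce simp: comp_def)

lemma diagonalizer_in_chart:
  assumes "local_diagonalizer X \<A> (M 1) p W C"
  shows "real_analytic_at (\<lambda>s. C (inv_into U \<phi> s)) (\<phi> p)"
    "\<forall>\<^sub>F s in nhds (\<phi> p). C (inv_into U \<phi> s) \<in> SL"
    "\<forall>\<^sub>F s in nhds (\<phi> p). is_diagonal (conjugate_by (C (inv_into U \<phi> s)) (M 1 (inv_into U \<phi> s)))"
    "i \<noteq> j \<Longrightarrow> \<not> (\<forall>\<^sub>F s in nhds (\<phi> p).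
       conjugate_by (C (inv_into U \<phi> s)) (M 1 (inv_into U \<phi> s)) $ i $ i =
       conjugate_by (C (inv_into U \<phi> s)) (M 1 (inv_into U \<phi> s)) $ j $ j)"
proof -
  have W: "openin X W" "p \<in> W" "curve_analytic_on \<A> W C" "C ` W \<subseteq> SL"
    "\<And>x. x \<in> W \<Longrightarrow> is_diagonal (conjugate_by (C x) (M 1 x))"
    using assms by (auto simp: local_diagonalizer_def)
  show "real_analytic_at (\<lambda>s. C (inv_into U \<phi> s)) (\<phi> p)"
    by (rule curve_analytic_in_chart[OF W(3,2)])
  show "\<forall>\<^sub>F s in nhds (\<phi> p). C (inv_into U \<phi> s) \<in> SL"
    using eventually_chart_openin[OF W(1,2)] by eventually_elim (use W(4) in blast)
  show "\<forall>\<^sub>F s in nhds (\<phi> p). is_diagonal (conjugate_by (C (inv_into U \<phi> s)) (M 1 (inv_into U \<phi> s)))"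
    using eventually_chart_openin[OF W(1,2)] by eventually_elim (rule W(5))
  show "\<not> (\<forall>\<^sub>F s in nhds (\<phi> p).
       conjugate_by (C (inv_into U \<phi> s)) (M 1 (inv_into U \<phi> s)) $ i $ i =
       conjugate_by (C (inv_into U \<phi> s)) (M 1 (inv_into U \<phi> s)) $ j $ j)" if "i \<noteq> j"
    using distinct[OF p] assms that
      eventually_chart[of "\<lambda>x. conjugate_by (C x) (M 1 x) $ i $ i = conjugate_by (C x) (M 1 x) $ j $ j"]
    unfolding local_eigenvalues_distinct_def by blast
qed

lemma forms_near:
  assumes compat: "compatible_at p" and exist: "\<And>x. x \<in> topspace X \<Longrightarrow> forms x \<noteq> {}"
  obtains Q where "real_analytic_at Q (\<phi> p)"
    "\<forall>\<^sub>F s in nhds (\<phi> p). Q s \<in> forms (inv_into U \<phi> s)"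
    "\<forall>\<^sub>F s in at (\<phi> p). forms (inv_into U \<phi> s) \<subseteq> {Q s}"
proof -
  obtain W C where WC: "local_diagonalizer X \<A> (M 1) p W C"
    using diagonalizable[OF p] by (auto simp: locally_diagonalizable_at_def)
  obtain G where G: "connected_graph G"
      "G_compatible_at \<A> G p (\<lambda>x. conjugate_by (C x) (M 2 x))
          (\<lambda>x. matrix_inv (conj_transpose (conjugate_by (C x) (M 2 x))))"
    using compat WC unfolding compatible_at_def by blast
  note D = diagonalizer_in_chart[OF WC]
  have "\<exists>Q. real_analytic_at Q (\<phi> p) \<and>
      (\<forall>\<^sub>F s in nhds (\<phi> p). Q s \<in> invariant_forms ((\<lambda>k. M k (inv_into U \<phi> s)) ` {1..q})) \<and>
      (\<forall>\<^sub>F s in at (\<phi> p). invariant_forms ((\<lambda>k. M k (inv_into U \<phi> s)) ` {1..q}) \<subseteq> {Q s})"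
  proof (rule ex_analytic_invariant_form[where C = "\<lambda>s. C (inv_into U \<phi> s)" and a = 1 and b = 2 and G = G])
    show "real_analytic_at (\<lambda>s. M k (inv_into U \<phi> s)) (\<phi> p)" if "k \<in> {1..q}" for k
      by (rule curve_analytic_in_chart[OF M_analytic[OF that] p])
    show "\<forall>\<^sub>F s in nhds (\<phi> p). \<forall>k\<in>{1..q}. M k (inv_into U \<phi> s) \<in> SL"
      using eventually_chart_topspace by eventually_elim (use M_in_SL in blast)
    show "\<forall>\<^sub>F s in at (\<phi> p). invariant_forms ((\<lambda>k. M k (inv_into U \<phi> s)) ` {1..q}) \<noteq> {}"
      using eventually_nhds_imp_at[OF eventually_chart_topspace] by eventually_elim (rule exist)
    fix i j assume "(i, j) \<in> G"
    with G(2) chart pU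
    show "vanishing_order (\<lambda>s. conjugate_by (C (inv_into U \<phi> s)) (M 2 (inv_into U \<phi> s)) $ i $ j) (\<phi> p)
        = vanishing_order (\<lambda>s. matrix_inv (conj_transpose (conjugate_by (C (inv_into U \<phi> s)) (M 2 (inv_into U \<phi> s)))) $ i $ j) (\<phi> p) \<and>
      vanishing_order (\<lambda>s. conjugate_by (C (inv_into U \<phi> s)) (M 2 (inv_into U \<phi> s)) $ i $ j) (\<phi> p) < \<infinity>"
      unfolding G_compatible_at_def by fastforce
  qed (use D G(1) q in auto)
  with that show thesis by blast
qed

end

text \<open>The value at \<open>p\<close> has to be fixed even if several invariant forms exist there. Taking the limit at
\<open>p\<close> of arbitrarily chosen forms \<open>F\<close> is independent of any chart, and is the value at \<open>p\<close> of the
local analytic form, because \<open>F\<close> agrees with that form in a punctured neighbourhood.\<close>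

lemma ex_analytic_form:
  assumes compat: "\<And>p. p \<in> topspace X \<Longrightarrow> compatible_at p"
    and exist: "\<And>x. x \<in> topspace X \<Longrightarrow> forms x \<noteq> {}"
  obtains Q where "curve_analytic_on \<A> (topspace X) Q" "\<And>x. x \<in> topspace X \<Longrightarrow> Q x \<in> forms x"
proof -
  define F where "F x = (SOME H. H \<in> forms x)" for x
  have F: "F x \<in> forms x" if "x \<in> topspace X" for x
    using exist[OF that] unfolding F_def by (simp add: some_in_eq)
  define Q where "Q p = Lim (atin X p) F" for p
  have local: "\<exists>R. real_analytic_at R (\<phi> p) \<and> Q p = R (\<phi> p) \<and> Q p \<in> forms p \<and>
      (\<forall>\<^sub>F s in at (\<phi> p). forms (inv_into U \<phi> s) \<subseteq> {R s})"
    if p: "p \<in> topspace X" and chart: "(U, \<phi>) \<in> \<A>" "p \<in> U" for p U \<phi>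
  proof -
    obtain R where R: "real_analytic_at R (\<phi> p)"
      "\<forall>\<^sub>F s in nhds (\<phi> p). R s \<in> forms (inv_into U \<phi> s)"
      "\<forall>\<^sub>F s in at (\<phi> p). forms (inv_into U \<phi> s) \<subseteq> {R s}"
      by (rule forms_near[OF p chart compat[OF p]]) (rule exist)
    have "\<forall>\<^sub>F s in at (\<phi> p). R s = F (inv_into U \<phi> s)"
      using R(3) eventually_nhds_imp_at[OF eventually_chart_topspace[OF p chart]]
    proof eventually_elim
      case (elim s)
      show ?case using F[OF elim(2)] elim(1) by auto
    qed
    moreover have "(R \<longlongrightarrow> R (\<phi> p)) (at (\<phi> p))"
      using real_analytic_at_matrix_continuous[OF R(1)] by (simp add: isCont_def)
    ultimately have "((\<lambda>s. F (inv_into U \<phi> s)) \<longlongrightarrow> R (\<phi> p)) (at (\<phi> p))"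
      by (simp add: tendsto_cong)
    then have "(F \<longlongrightarrow> R (\<phi> p)) (atin X p)"
      by (simp add: atin_eq_filtermap_chart[OF curve chart] filterlim_filtermap)
    moreover have "atin X p \<noteq> bot"
      by (simp add: atin_eq_filtermap_chart[OF curve chart] filtermap_bot_iff)
    ultimately have "Q p = R (\<phi> p)"
      unfolding Q_def by (intro tendsto_Lim)
    moreover have "R (\<phi> p) \<in> forms p"
      using eventually_nhds_x_imp_x[OF R(2)] by (simp add: inv_chart[OF p chart])
    ultimately show ?thesis using R(1,3) by auto
  qed
  have Q_form: "Q x \<in> forms x" if "x \<in> topspace X" for x
    using local[OF that] ex_chart[OF that] by metis
  have "real_analytic_at (Q \<circ> inv_into U \<phi>) (\<phi> p)"
    if chart: "(U, \<phi>) \<in> \<A>" "p \<in> U" and p: "p \<in> topspace X" for U \<phi> p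
  proof -
    obtain R where R: "real_analytic_at R (\<phi> p)" "Q p = R (\<phi> p)"
        "\<forall>\<^sub>F s in at (\<phi> p). forms (inv_into U \<phi> s) \<subseteq> {R s}"
      using local[OF p chart] by blast
    have "\<forall>\<^sub>F s in at (\<phi> p). Q (inv_into U \<phi> s) = R s"
      using R(3) eventually_nhds_imp_at[OF eventually_chart_topspace[OF p chart]]
    proof eventually_elim
      case (elim s)
      show ?case using Q_form[OF elim(2)] elim(1) by auto
    qed
    then have "\<forall>\<^sub>F s in nhds (\<phi> p). (Q \<circ> inv_into U \<phi>) s = R s"
      using R(2) by (simp add: eventually_nhds_conv_at inv_chart[OF p chart])
    with R(1) show ?thesis by (simp add: real_analytic_at_cong)
  qed
  then have "curve_analytic_on \<A> (topspace X) Q"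
    unfolding curve_analytic_on_def by auto
  with Q_form that show thesis by blast
qed

lemma globally_unitarizable_if:
  assumes compat: "\<And>p. p \<in> topspace X \<Longrightarrow> compatible_at p"
    and exist: "\<And>x. x \<in> topspace X \<Longrightarrow> forms x \<noteq> {}"
  shows "globally_unitarizable X \<A> q M"
proof -
  obtain Q where Q: "curve_analytic_on \<A> (topspace X) Q" "\<And>x. x \<in> topspace X \<Longrightarrow> Q x \<in> forms x"
    using ex_analytic_form[OF assms] by blast
  have Q': "Q x \<in> invariant_forms {}" if "x \<in> topspace X" for x
    using Q(2)[OF that] invariant_forms_antimono[of "{}"] by blast
  obtain \<Phi> :: "complex ^ 'n ^ 'n \<Rightarrow> complex ^ 'n ^ 'n" where
    \<Phi>: "\<And>H. H \<in> invariant_forms {} \<Longrightarrow> \<Phi> H \<in> SL"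
    "\<And>H. H \<in> invariant_forms {} \<Longrightarrow> conj_transpose (\<Phi> H) ** \<Phi> H = H"
    "\<And>Q t. real_analytic_at Q t \<Longrightarrow> \<forall>\<^sub>F s in nhds t. Q s \<in> invariant_forms {} \<Longrightarrow>
       real_analytic_at (\<lambda>s. \<Phi> (Q s)) t"
    using analytic_gram_factor by blast
  have "real_analytic_at ((\<lambda>x. \<Phi> (Q x)) \<circ> inv_into U \<phi>) (\<phi> p)"
    if chart: "(U, \<phi>) \<in> \<A>" "p \<in> U" and p: "p \<in> topspace X" for U \<phi> p
    unfolding comp_def
  proof (rule \<Phi>(3))
    show "real_analytic_at (\<lambda>s. Q (inv_into U \<phi> s)) (\<phi> p)"
      by (rule curve_analytic_in_chart[OF p chart Q(1) p])
    show "\<forall>\<^sub>F s in nhds (\<phi> p). Q (inv_into U \<phi> s) \<in> invariant_forms {}"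
      using eventually_chart_topspace[OF p chart] by eventually_elim (rule Q')
  qed
  then have "curve_analytic_on \<A> (topspace X) (\<lambda>x. \<Phi> (Q x))"
    unfolding curve_analytic_on_def by auto
  moreover have "\<forall>k\<in>{1..q}. conjugate_by (\<Phi> (Q x)) (M k x) \<in> SU" if "x \<in> topspace X" for x
    using unitarizes_iff_form[OF \<Phi>(1)[OF Q'[OF that]] that] \<Phi>(2)[OF Q'[OF that]] Q(2)[OF that] by simp
  ultimately have "simultaneous_unitarizer X \<A> q M (\<lambda>x. \<Phi> (Q x))"
    using \<Phi>(1)[OF Q'] by (auto simp: simultaneous_unitarizer_def)
  then show ?thesis unfolding globally_unitarizable_def by blast
qed

lemma unitarizer_form:
  assumes "simultaneous_unitarizer X \<A> q M V" "x \<in> topspace X"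
  shows "V x \<in> SL" "conj_transpose (V x) ** V x \<in> forms x"
proof -
  show SL: "V x \<in> SL" using assms by (auto simp: simultaneous_unitarizer_def)
  have "\<forall>k\<in>{1..q}. conjugate_by (V x) (M k x) \<in> SU"
    using assms unfolding simultaneous_unitarizer_def by blast
  then show "conj_transpose (V x) ** V x \<in> forms x"
    using unitarizes_iff_form[OF SL assms(2)] by blast
qed

text \<open>The exceptional set \<open>S\<close> is only required to consist of isolated points and may accumulate at points
outside \<open>S\<close>. An open set contained in \<open>S\<close> would nevertheless contain an isolated point of the curve,
and a curve has none.\<close>

lemma not_eventually_reducible:
  assumes irr: "irreducible_except_isolated X (M 1) (M 2)" and p: "p \<in> topspace X"
  shows "\<not> (\<forall>\<^sub>F x in nhdsin X p. reducible_pair (M 1 x) (M 2 x))"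
proof
  assume red: "\<forall>\<^sub>F x in nhdsin X p. reducible_pair (M 1 x) (M 2 x)"
  obtain S where S: "S \<subseteq> topspace X" "\<forall>p\<in>S. \<exists>U. openin X U \<and> U \<inter> S = {p}"
      "\<forall>p\<in>topspace X - S. \<not> reducible_pair (M 1 p) (M 2 p)"
    using irr unfolding irreducible_except_isolated_def by auto
  obtain T where T: "openin X T" "p \<in> T" "\<forall>x\<in>T. reducible_pair (M 1 x) (M 2 x)"
    using red p unfolding eventually_nhdsin by auto
  have TS: "T \<subseteq> S"
  proof
    fix x assume "x \<in> T"
    then show "x \<in> S" using S(3) T(3) openin_subset[OF T(1)] by auto
  qed
  then have "p \<in> S" using T(2) by auto
  then obtain W where W: "openin X W" "W \<inter> S = {p}" using S(2) by auto
  have "openin X (T \<inter> W) \<and> p \<in> T \<inter> W \<and> (\<forall>x\<in>(T \<inter> W) - {p}. False)"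
    using openin_Int[OF T(1) W(1)] T(2) TS W(2) by auto
  then have "\<forall>\<^sub>F x in atin X p. False"
    unfolding eventually_atin by (intro disjI2 exI)
  moreover obtain U \<phi> where chart: "(U, \<phi>) \<in> \<A>" "p \<in> U" using ex_chart[OF p] .
  ultimately show False
    by (simp add: atin_eq_filtermap_chart[OF curve chart] eventually_filtermap)
qed

text \<open>The graph consists of the entries of \<open>P\<close> that do not vanish identically near \<open>p\<close>. A point close to
\<open>p\<close> where the remaining entries vanish and the pair is irreducible shows that it is connected.\<close>

lemma unitarizable_imp_compatible:
  assumes irr: "irreducible_except_isolated X (M 1) (M 2)"
    and V: "simultaneous_unitarizer X \<A> q M V" and p: "p \<in> topspace X"
  shows "compatible_at p"
  unfolding compatible_at_def
proof (intro allI impI)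
  fix W C assume WC: "local_diagonalizer X \<A> (M 1) p W C"
  let ?D = "\<lambda>x. conjugate_by (C x) (M 1 x)" and ?P = "\<lambda>x. conjugate_by (C x) (M 2 x)"
  define G where "G = {(i, j). \<not> (\<forall>\<^sub>F x in nhdsin X p. ?P x $ i $ j = 0)}"
  have W: "openin X W" "p \<in> W" "C ` W \<subseteq> SL" "\<And>x. x \<in> W \<Longrightarrow> is_diagonal (?D x)"
    using WC by (auto simp: local_diagonalizer_def)
  have idx: "1 \<in> {1..q}" "2 \<in> {1..q}" using q by auto

  have "connected_graph G"
  proof -
    have "\<forall>\<^sub>F x in nhdsin X p. (i, j) \<notin> G \<longrightarrow> ?P x $ i $ j = 0" for i j
      by (cases "(i, j) \<in> G") (auto simp: G_def)
    then have "\<forall>\<^sub>F x in nhdsin X p. \<forall>i j. (i, j) \<notin> G \<longrightarrow> ?P x $ i $ j = 0"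
      by (intro eventually_all_finite)
    moreover have "\<forall>\<^sub>F x in nhdsin X p. x \<in> W"
      using W(1,2) unfolding eventually_nhdsin by blast
    ultimately have ev: "\<forall>\<^sub>F x in nhdsin X p. x \<in> W \<and> (\<forall>i j. (i, j) \<notin> G \<longrightarrow> ?P x $ i $ j = 0)"
      by eventually_elim blast
    have "\<exists>x. (x \<in> W \<and> (\<forall>i j. (i, j) \<notin> G \<longrightarrow> ?P x $ i $ j = 0)) \<and> \<not> reducible_pair (M 1 x) (M 2 x)"
    proof (rule ccontr)
      assume none: "\<not> ?thesis"
      have "\<forall>\<^sub>F x in nhdsin X p. reducible_pair (M 1 x) (M 2 x)"
        by (rule eventually_mono[OF ev]) (use none in blast)
      with not_eventually_reducible[OF irr p] show False ..
    qed
    then obtain x where x: "x \<in> W" "\<And>i j. (i, j) \<notin> G \<Longrightarrow> ?P x $ i $ j = 0"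
        "\<not> reducible_pair (M 1 x) (M 2 x)"
      by blast
    have "connected_graph {(i, j). ?P x $ i $ j \<noteq> 0}"
      using irreducible_imp_connected_graph[OF x(3) _ W(4)[OF x(1)]] W(3) x(1) by blast
    moreover have "{(i, j). ?P x $ i $ j \<noteq> 0} \<subseteq> G" using x(2) by auto
    then have "({(i, j). ?P x $ i $ j \<noteq> 0} \<union> {(i, j). ?P x $ i $ j \<noteq> 0}\<inverse>)\<^sup>* \<subseteq> (G \<union> G\<inverse>)\<^sup>*"
      by (intro rtrancl_mono) blast
    ultimately show ?thesis unfolding connected_graph_def by auto
  qed
  moreover have "G_compatible_at \<A> G p ?P (\<lambda>x. matrix_inv (conj_transpose (?P x)))"
    unfolding G_compatible_at_def
  proof (clarify)
    fix U \<phi> i j assume chart: "(U, \<phi>) \<in> \<A>" "p \<in> U" and ij: "(i, j) \<in> G"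
    let ?i = "inv_into U \<phi>"
    define H where "H x =
      conj_transpose (matrix_inv (C x)) ** (conj_transpose (V x) ** V x) ** matrix_inv (C x)" for x
    note D = diagonalizer_in_chart[OF p chart WC]
    have M: "real_analytic_at (\<lambda>s. M k (?i s)) (\<phi> p)" if "k \<in> {1..q}" for k
      by (rule curve_analytic_in_chart[OF p chart M_analytic[OF that] p])
    have VA: "real_analytic_at (\<lambda>s. V (?i s)) (\<phi> p)"
      by (rule curve_analytic_in_chart[OF p chart _ p])
        (use V in \<open>simp add: simultaneous_unitarizer_def\<close>)
    have conj: "real_analytic_at (\<lambda>s. conjugate_by (C (?i s)) (M k (?i s))) (\<phi> p)" if "k \<in> {1..q}" for k
      unfolding conjugate_by_def using M[OF that] D(1,2) by (intro real_analytic_intros)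
    have HA: "real_analytic_at (\<lambda>s. H (?i s)) (\<phi> p)"
      unfolding H_def using VA D(1,2) by (intro real_analytic_intros)
    have SL: "\<forall>\<^sub>F s in nhds (\<phi> p). ?P (?i s) \<in> SL"
      using D(2) eventually_chart_topspace[OF p chart]
      by eventually_elim (use M_in_SL[OF idx(2)] in \<open>auto intro: SL_conjugate_by\<close>)
    have form: "\<forall>\<^sub>F s in nhds (\<phi> p). H (?i s) \<in> invariant_forms {?D (?i s), ?P (?i s)}"
      using D(2) eventually_chart_topspace[OF p chart]
    proof eventually_elim
      case (elim s)
      have "H (?i s) \<in> invariant_forms (conjugate_by (C (?i s)) ` (\<lambda>k. M k (?i s)) ` {1..q})"
        unfolding H_def using elim(1) unitarizer_form(2)[OF V elim(2)]
        by (rule invariant_forms_to_conjugates)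
      moreover have "{?D (?i s), ?P (?i s)} \<subseteq> conjugate_by (C (?i s)) ` (\<lambda>k. M k (?i s)) ` {1..q}"
        using idx by blast
      ultimately show ?case using invariant_forms_antimono by blast
    qed
    have "\<not> (\<forall>\<^sub>F s in nhds (\<phi> p). ?P (?i s) $ i $ j = 0)"
      using ij eventually_chart[OF p chart, of "\<lambda>x. ?P x $ i $ j = 0"] by (simp add: G_def)
    from invariant_form_imp_equal_orders[OF conj[OF idx(1)] conj[OF idx(2)] HA SL D(3,4) form this]
    show "vanishing_order (\<lambda>t. ?P (?i t) $ i $ j) (\<phi> p)
          = vanishing_order (\<lambda>t. matrix_inv (conj_transpose (?P (?i t))) $ i $ j) (\<phi> p) \<and>
        vanishing_order (\<lambda>t. ?P (?i t) $ i $ j) (\<phi> p) < \<infinity>"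
      by blast
  qed
  ultimately show "\<exists>G. connected_graph G \<and>
      G_compatible_at \<A> G p ?P (\<lambda>x. matrix_inv (conj_transpose (?P x)))"
    by blast
qed

text \<open>The forms of \<open>V\<close> and \<open>W\<close> coincide in a punctured neighbourhood of each point by uniqueness, hence at
the point by continuity. Then \<open>W V\<inverse>\<close> is unitary.\<close>

lemma unitarizer_unique:
  assumes irr: "irreducible_except_isolated X (M 1) (M 2)"
    and V: "simultaneous_unitarizer X \<A> q M V" and W: "simultaneous_unitarizer X \<A> q M W"
  shows "\<exists>U. curve_analytic_on \<A> (topspace X) U \<and> U ` topspace X \<subseteq> SU \<and>
    (\<forall>x\<in>topspace X. W x = U x ** V x)"
proof -
  have analytic: "real_analytic_at (\<lambda>s. V' (inv_into U \<phi> s)) (\<phi> p)"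
    if "simultaneous_unitarizer X \<A> q M V'" "p \<in> topspace X" "(U, \<phi>) \<in> \<A>" "p \<in> U" for V' U \<phi> p
    using that by (intro curve_analytic_in_chart[of p U \<phi> "topspace X"]) (auto simp: simultaneous_unitarizer_def)
  have same_form: "conj_transpose (W p) ** W p = conj_transpose (V p) ** V p" if p: "p \<in> topspace X" for p
  proof -
    obtain U \<phi> where chart: "(U, \<phi>) \<in> \<A>" "p \<in> U" using ex_chart[OF p] .
    have exist: "forms x \<noteq> {}" if "x \<in> topspace X" for x
      using unitarizer_form(2)[OF V that] by blast
    obtain Q where Q: "real_analytic_at Q (\<phi> p)"
      "\<forall>\<^sub>F s in nhds (\<phi> p). Q s \<in> forms (inv_into U \<phi> s)"
      "\<forall>\<^sub>F s in at (\<phi> p). forms (inv_into U \<phi> s) \<subseteq> {Q s}"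
      by (rule forms_near[OF p chart unitarizable_imp_compatible[OF irr V p]]) (rule exist)
    let ?h = "\<lambda>V' s. conj_transpose (V' (inv_into U \<phi> s)) ** V' (inv_into U \<phi> s)"
    have cont: "isCont (?h V') (\<phi> p)" if "simultaneous_unitarizer X \<A> q M V'" for V'
      using analytic[OF that p chart] by (intro real_analytic_at_matrix_continuous real_analytic_intros)
    have "\<forall>\<^sub>F s in at (\<phi> p). ?h W s = ?h V s"
      using Q(3) eventually_nhds_imp_at[OF eventually_chart_topspace[OF p chart]]
    proof eventually_elim
      case (elim s)
      show ?case
        using subsetD[OF elim(1) unitarizer_form(2)[OF V elim(2)]]
          subsetD[OF elim(1) unitarizer_form(2)[OF W elim(2)]] by simp
    qed
    then have "?h W (\<phi> p) = ?h V (\<phi> p)"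
      by (rule continuous_eq_at_limit[OF cont[OF W] cont[OF V]])
    then show ?thesis by (simp add: inv_chart[OF p chart])
  qed
  define T where "T x = W x ** matrix_inv (V x)" for x
  have "real_analytic_at (T \<circ> inv_into U \<phi>) (\<phi> p)"
    if chart: "(U, \<phi>) \<in> \<A>" "p \<in> U" and p: "p \<in> topspace X" for U \<phi> p
  proof -
    have "\<forall>\<^sub>F s in nhds (\<phi> p). V (inv_into U \<phi> s) \<in> SL"
      using eventually_chart_topspace[OF p chart] by eventually_elim (rule unitarizer_form(1)[OF V])
    then show ?thesis
      unfolding T_def comp_def using analytic[OF V p chart] analytic[OF W p chart]
      by (intro real_analytic_intros)
  qed
  then have "curve_analytic_on \<A> (topspace X) T"
    unfolding curve_analytic_on_def by auto
  moreover have "T x \<in> SU" "W x = T x ** V x" if x: "x \<in> topspace X" for x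
  proof -
    note VS = unitarizer_form(1)[OF V x] and WS = unitarizer_form(1)[OF W x]
    have "conj_transpose (T x) ** T x =
        conj_transpose (matrix_inv (V x)) ** ((conj_transpose (W x) ** W x) ** matrix_inv (V x))"
      by (simp add: T_def conj_transpose_mult matrix_mul_assoc)
    also have "\<dots> = conj_transpose (V x ** matrix_inv (V x)) ** (V x ** matrix_inv (V x))"
      by (simp add: same_form[OF x] conj_transpose_mult matrix_mul_assoc)
    also have "\<dots> = mat 1" by (simp add: SL_inverse[OF VS])
    finally show "T x \<in> SU"
      using SL_mult[OF WS SL_matrix_inv[OF VS]] by (simp add: SU_def SL_def T_def)
    show "W x = T x ** V x"
      by (simp add: T_def SL_inverse[OF VS] flip: matrix_mul_assoc)
  qed
  ultimately show ?thesis by blast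
qed

end

theorem theorem2p7:
  fixes X :: "'a topology"
    and \<A> :: "('a set \<times> ('a \<Rightarrow> real)) set"
    and q :: nat
    and M :: "nat \<Rightarrow> 'a \<Rightarrow> complex ^ 'n ^ 'n"
  assumes curve: "analytic_curve X \<A>"
    and q: "q \<ge> 2"
    and M_analytic: "\<And>k. k \<in> {1..q} \<Longrightarrow> curve_analytic_on \<A> (topspace X) (M k)"
    and M_SL: "\<And>k. k \<in> {1..q} \<Longrightarrow> M k ` topspace X \<subseteq> SL"
    and irreducible: "irreducible_except_isolated X (M 1) (M 2)"
    and diagonalizable: "\<And>p. p \<in> topspace X \<Longrightarrow> locally_diagonalizable_at X \<A> (M 1) p"
    and distinct: "\<And>p. p \<in> topspace X \<Longrightarrow> local_eigenvalues_distinct X \<A> (M 1) p"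
  shows "(globally_unitarizable X \<A> q M \<longleftrightarrow>
            (\<forall>p\<in>topspace X. pointwise_unitarizable_at q M p) \<and>
            (\<forall>p\<in>topspace X. \<forall>U C. local_diagonalizer X \<A> (M 1) p U C \<longrightarrow>
               (\<exists>G. connected_graph G \<and>
                  G_compatible_at \<A> G p
                    (\<lambda>x. conjugate_by (C x) (M 2 x))
                    (\<lambda>x. matrix_inv (conj_transpose (conjugate_by (C x) (M 2 x)))))))
         \<and> (\<forall>V W. simultaneous_unitarizer X \<A> q M V \<and> simultaneous_unitarizer X \<A> q M W \<longrightarrow>
              (\<exists>U. curve_analytic_on \<A> (topspace X) U \<and> U ` topspace X \<subseteq> SU \<and>
                   (\<forall>x\<in>topspace X. W x = U x ** V x)))"
proof -
  interpret diagonalizable_maps X \<A> q M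
    using curve q M_analytic M_SL diagonalizable distinct by unfold_locales
  have "globally_unitarizable X \<A> q M \<longleftrightarrow>
      (\<forall>p\<in>topspace X. pointwise_unitarizable_at q M p) \<and> (\<forall>p\<in>topspace X. compatible_at p)"
  proof
    assume "globally_unitarizable X \<A> q M"
    then obtain V where V: "simultaneous_unitarizer X \<A> q M V"
      unfolding globally_unitarizable_def by blast
    show "(\<forall>p\<in>topspace X. pointwise_unitarizable_at q M p) \<and> (\<forall>p\<in>topspace X. compatible_at p)"
      using unitarizer_form(2)[OF V] pointwise_unitarizable_iff
        unitarizable_imp_compatible[OF irreducible V] by blast
  next
    assume "(\<forall>p\<in>topspace X. pointwise_unitarizable_at q M p) \<and> (\<forall>p\<in>topspace X. compatible_at p)"
    then show "globally_unitarizable X \<A> q M"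
      using pointwise_unitarizable_iff by (intro globally_unitarizable_if) blast+
  qed
  then show ?thesis
    unfolding compatible_at_def
    by (intro conjI allI impI) (assumption, elim conjE, rule unitarizer_unique[OF irreducible])
qed

end
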